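(* Let $T:X\to Y$ be an operator between Banach spaces such that $T^*(B_{Y^*})\subseteq X^*$ has the OT property. Let $(\Omega,\Sigma)$ be a measurable space and let $\nu\in{\rm ca}(\Sigma,Y)$ be such that $I_\nu(L_1(\nu))\subseteq T(X)$. Then there is $\tilde\nu\in{\rm ca}(\Sigma,X)$ such that: (a) $\nu=T\circ\tilde\nu$ and $\mathcal{N}(\nu)=\mathcal{N}(\tilde\nu)$; (b) $L_1(\nu)=L_1(\tilde\nu)$ (with equivalent norms); and (c) $I_\nu=T\circ I_{\tilde\nu}$.
   Context: All Banach spaces are real. An operator is a continuous linear map between Banach spaces; $B_{Y^*}$ is the closed unit ball of $Y^*$; $T^*$ is the adjoint of $T$. For a $\sigma$-algebra $\Sigma$ and a Banach space $X$, ${\rm ca}(\Sigma,X)$ is the set of all countably additive $X$-valued measures on $\Sigma$, and ${\rm ca}(\Sigma)={\rm ca}(\Sigma,\mathbb{R})$. A set $W\subseteq X^*$ has the Orlicz-Thomas (OT) property if, for every map $\eta:\Sigma'\to X$ defined on a $\sigma$-algebra $\Sigma'$, we have $\eta\in {\rm ca}(\Sigma',X)$ whenever $x^*\circ\eta\in {\rm ca}(\Sigma')$ for all $x^*\in W$. Let $Z$ be a Banach space and $\eta\in{\rm ca}(\Sigma,Z)$, with $\Sigma$ a $\sigma$-algebra on $\Omega$. For $z^*\in Z^*$, $|z^*\circ\eta|$ is the variation of $z^*\circ\eta$. A set $A\in\Sigma$ is $\eta$-null if $\eta(B)=0$ for every $B\in\Sigma$ with $B\subseteq A$; $\mathcal{N}(\eta)$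 is the family of all $\eta$-null sets. A $\Sigma$-measurable $f:\Omega\to\mathbb{R}$ is $\eta$-integrable if $f\in L_1(|z^*\circ\eta|)$ for all $z^*\in Z^*$ and, for each $A\in\Sigma$, there is $\int_A f\,d\eta\in Z$ with $z^*\left(\int_A f\,d\eta\right)=\int_A f\,d(z^*\circ\eta)$ for all $z^*\in Z^*$. Identifying functions which coincide $\eta$-a.e., $L_1(\eta)$ is the Banach space of all (classes of) $\eta$-integrable functions with the norm $\|f\|_{L_1(\eta)}=\sup_{z^*\in B_{Z^*}}\int_\Omega|f|\,d|z^*\circ\eta|$. The integration operator $I_\eta:L_1(\eta)\to Z$ is $I_\eta(f)=\int_\Omega f\,d\eta$. *)

theory Defs
  imports "HOL-Analysis.Analysis"
begin

text \<open>
  A measurable space \<open>(\<Omega>, \<Sigma>)\<close> is given by a measure \<open>M\<close> with \<open>\<Omega> = space M\<close> and \<open>\<Sigma> = sets M\<close>;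
  the values \<open>emeasure M\<close> are never used. Set functions are total in HOL; only their values on
  \<open>sets M\<close> matter.
\<close>

definition ca :: "'w measure \<Rightarrow> ('w set \<Rightarrow> 'a::real_normed_vector) set" where
  "ca M = {\<eta>. \<forall>A :: nat \<Rightarrow> 'w set. range A \<subseteq> sets M \<longrightarrow> disjoint_family A \<longrightarrow>
              (\<lambda>n. \<eta> (A n)) sums \<eta> (\<Union>n. A n)}"

lemma caD:
  assumes "\<eta> \<in> ca M" "range A \<subseteq> sets M" "disjoint_family A"
  shows "(\<lambda>n. \<eta> (A n)) sums \<eta> (\<Union>n. A n)"
  using assms by (simp add: ca_def)

definition dual_map ::
  "('a::real_normed_vector \<Rightarrow>\<^sub>L 'b::real_normed_vector) \<Rightarrow> ('b \<Rightarrow>\<^sub>L real) \<Rightarrow> ('a \<Rightarrow>\<^sub>L real)" where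
  "dual_map T y = y o\<^sub>L T"

subsection \<open>The Orlicz-Thomas property\<close>

definition OT_property_on :: "'w itself \<Rightarrow> ('a::real_normed_vector \<Rightarrow>\<^sub>L real) set \<Rightarrow> bool" where
  "OT_property_on _ W \<longleftrightarrow>
     (\<forall>(M :: 'w measure) \<eta>. (\<forall>x\<in>W. blinfun_apply x \<circ> \<eta> \<in> ca M) \<longrightarrow> \<eta> \<in> ca M)"

text \<open>
  HOL cannot quantify over all underlying types of a \<open>\<sigma>\<close>-algebra within a formula. Taking \<open>\<sigma>\<close>-algebras
  of sets of natural numbers loses nothing: the two lemmas below show that this instance
  implies the property for \<open>\<sigma>\<close>-algebras over any type, and is implied by the property over
  any one infinite type.
\<close>

definition OT_property :: "('a::real_normed_vector \<Rightarrow>\<^sub>L real) set \<Rightarrow> bool" where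
  "OT_property W \<longleftrightarrow> OT_property_on TYPE(nat) W"

lemma OT_property_imp_OT_property_on:
  assumes "OT_property (W :: ('a::real_normed_vector \<Rightarrow>\<^sub>L real) set)"
  shows "OT_property_on TYPE('w) W"
  unfolding OT_property_on_def
proof (intro allI impI)
  fix M :: "'w measure" and \<eta> :: "'w set \<Rightarrow> 'a"
  assume H: "\<forall>x\<in>W. blinfun_apply x \<circ> \<eta> \<in> ca M"
  show "\<eta> \<in> ca M"
    unfolding ca_def
  proof (intro CollectI allI impI)
    fix A :: "nat \<Rightarrow> 'w set"
    assume A: "range A \<subseteq> sets M" "disjoint_family A"
    define \<theta> where "\<theta> N = \<eta> (\<Union>n\<in>N. A n)" for N :: "nat set"
    have "blinfun_apply x \<circ> \<theta> \<in> ca (count_space UNIV)" if "x \<in> W" for x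
      unfolding ca_def
    proof (intro CollectI allI impI)
      fix B :: "nat \<Rightarrow> nat set"
      assume B: "disjoint_family B"
      let ?C = "\<lambda>k. \<Union>n\<in>B k. A n"
      have "range ?C \<subseteq> sets M" using A(1) by auto
      moreover have "disjoint_family ?C"
        unfolding disjoint_family_on_def
      proof (intro ballI impI)
        fix k l :: nat assume "k \<noteq> l"
        then have "B k \<inter> B l = {}" using B unfolding disjoint_family_on_def by blast
        then have "i \<noteq> j" if "i \<in> B k" "j \<in> B l" for i j using that by blast
        moreover have "A i \<inter> A j = {}" if "i \<noteq> j" for i j
          using A(2) that unfolding disjoint_family_on_def by blast
        ultimately have "A i \<inter> A j = {}" if "i \<in> B k" "j \<in> B l" for i j
          using that by simp
        then show "?C k \<inter> ?C l = {}" by (auto simp: disjoint_iff)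
      qed
      ultimately have "(\<lambda>k. (blinfun_apply x \<circ> \<eta>) (?C k)) sums (blinfun_apply x \<circ> \<eta>) (\<Union>k. ?C k)"
        by (rule caD[OF bspec[OF H that]])
      moreover have "(\<Union>k. ?C k) = (\<Union>n\<in>(\<Union>k. B k). A n)" by auto
      ultimately show "(\<lambda>k. (blinfun_apply x \<circ> \<theta>) (B k)) sums (blinfun_apply x \<circ> \<theta>) (\<Union>k. B k)"
        by (simp only: \<theta>_def o_apply)
    qed
    then have "\<theta> \<in> ca (count_space UNIV)"
      using assms unfolding OT_property_def OT_property_on_def by simp
    moreover have "range (\<lambda>n::nat. {n}) \<subseteq> sets (count_space UNIV)" "disjoint_family (\<lambda>n::nat. {n})"
      by (auto simp: disjoint_family_on_def)
    ultimately have "(\<lambda>n. \<theta> {n}) sums \<theta> (\<Union>n. {n})"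
      by (rule caD)
    then show "(\<lambda>n. \<eta> (A n)) sums \<eta> (\<Union>n. A n)"
      by (simp add: \<theta>_def)
  qed
qed

lemma OT_property_on_imp_OT_property:
  assumes "infinite (UNIV :: 'w set)" "OT_property_on TYPE('w) W"
  shows "OT_property (W :: ('a::real_normed_vector \<Rightarrow>\<^sub>L real) set)"
  unfolding OT_property_def OT_property_on_def
proof (intro allI impI)
  fix M :: "nat measure" and \<eta> :: "nat set \<Rightarrow> 'a"
  assume H: "\<forall>x\<in>W. blinfun_apply x \<circ> \<eta> \<in> ca M"
  obtain f :: "nat \<Rightarrow> 'w" where f: "inj f"
    using assms(1) infinite_countable_subset by blast
  define N where "N = sigma (f ` space M) ((`) f ` sets M)"
  have sa: "sigma_algebra (f ` space M) ((`) f ` sets M)"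
  proof (rule sigma_algebra_iff2[THEN iffD2], intro conjI ballI allI impI)
    show "(`) f ` sets M \<subseteq> Pow (f ` space M)"
      using sets.sets_into_space by blast
    show "{} \<in> (`) f ` sets M" by (metis image_empty image_eqI sets.empty_sets)
    fix s assume "s \<in> (`) f ` sets M"
    then obtain B where "B \<in> sets M" "s = f ` B" by blast
    then have "f ` space M - s = f ` (space M - B)" by (simp add: image_set_diff[OF f])
    then show "f ` space M - s \<in> (`) f ` sets M"
      using \<open>B \<in> sets M\<close> by blast
  next
    fix A :: "nat \<Rightarrow> 'w set" assume "range A \<subseteq> (`) f ` sets M"
    then have "\<forall>i. \<exists>B\<in>sets M. A i = f ` B" by blast
    then obtain B where B: "\<And>i. B i \<in> sets M" "\<And>i. A i = f ` B i" by metis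
    then have "(\<Union>i. A i) = f ` (\<Union>i. B i)" by auto
    then show "(\<Union>i. A i) \<in> (`) f ` sets M" using B(1) by blast
  qed
  have sets_N: "sets N = (`) f ` sets M"
    unfolding N_def by (simp add: sigma_algebra.sets_measure_of_eq[OF sa])
  define \<theta> where "\<theta> B = \<eta> (f -` B)" for B
  have vim: "f -` (f ` B) = B" for B using f by (rule inj_vimage_image_eq)
  have "blinfun_apply x \<circ> \<theta> \<in> ca N" if "x \<in> W" for x
    unfolding ca_def
  proof (intro CollectI allI impI)
    fix A :: "nat \<Rightarrow> 'w set"
    assume A: "range A \<subseteq> sets N" "disjoint_family A"
    have "range (\<lambda>n. f -` A n) \<subseteq> sets M" 
    proof safe
      fix n
      obtain B where "B \<in> sets M" "A n = f ` B" using A(1) unfolding sets_N by blast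
      then show "f -` A n \<in> sets M" by (simp add: vim)
    qed
    moreover have "disjoint_family (\<lambda>n. f -` A n)"
      using A(2) unfolding disjoint_family_on_def by blast
    ultimately have
      "(\<lambda>n. (blinfun_apply x \<circ> \<eta>) (f -` A n)) sums (blinfun_apply x \<circ> \<eta>) (\<Union>n. f -` A n)"
      using H that unfolding ca_def by blast
    then show "(\<lambda>n. (blinfun_apply x \<circ> \<theta>) (A n)) sums (blinfun_apply x \<circ> \<theta>) (\<Union>n. A n)"
      by (simp add: \<theta>_def vimage_Union vimage_UN)
  qed
  then have \<theta>: "\<theta> \<in> ca N"
    using assms(2) unfolding OT_property_on_def by blast
  show "\<eta> \<in> ca M"
    unfolding ca_def
  proof (intro CollectI allI impI)
    fix A :: "nat \<Rightarrow> nat set"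
    assume A: "range A \<subseteq> sets M" "disjoint_family A"
    have "range (\<lambda>n. f ` A n) \<subseteq> sets N" using A(1) unfolding sets_N by blast
    moreover have "disjoint_family (\<lambda>n. f ` A n)"
      using A(2) f unfolding disjoint_family_on_def by (simp flip: image_Int)
    ultimately have "(\<lambda>n. \<theta> (f ` A n)) sums \<theta> (\<Union>n. f ` A n)"
      using \<theta> unfolding ca_def by blast
    then show "(\<lambda>n. \<eta> (A n)) sums \<eta> (\<Union>n. A n)"
      by (simp add: \<theta>_def vim flip: image_UN)
  qed
qed

subsection \<open>Real-valued measures\<close>

text \<open>
  For \<open>\<mu> \<in> ca M\<close> the set functions passed to \<^const>\<open>measure_of\<close> below are countably additive,
  so its default to the zero measure does not occur.
\<close>

definition variation_measure :: "'w measure \<Rightarrow> ('w set \<Rightarrow> real) \<Rightarrow> 'w measure" where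
  "variation_measure M \<mu> = measure_of (space M) (sets M)
     (\<lambda>A. SUP P\<in>{P. finite P \<and> P \<subseteq> sets M \<and> partition_on A P}. \<Sum>B\<in>P. ennreal \<bar>\<mu> B\<bar>)"

definition positive_part_measure :: "'w measure \<Rightarrow> ('w set \<Rightarrow> real) \<Rightarrow> 'w measure" where
  "positive_part_measure M \<mu> = measure_of (space M) (sets M)
     (\<lambda>A. SUP B\<in>{B \<in> sets M. B \<subseteq> A}. ennreal (\<mu> B))"

text \<open>The integral against \<open>\<mu>\<close> by the Jordan decomposition \<open>\<mu> = \<mu>\<^sup>+ - (-\<mu>)\<^sup>+\<close>.\<close>

definition signed_set_integral ::
  "'w measure \<Rightarrow> ('w set \<Rightarrow> real) \<Rightarrow> 'w set \<Rightarrow> ('w \<Rightarrow> real) \<Rightarrow> real" where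
  "signed_set_integral M \<mu> A f =
     set_lebesgue_integral (positive_part_measure M \<mu>) A f
     - set_lebesgue_integral (positive_part_measure M (\<lambda>B. - \<mu> B)) A f"

subsection \<open>Integration with respect to a vector measure\<close>

definition vm_null_sets :: "'w measure \<Rightarrow> ('w set \<Rightarrow> 'a::real_normed_vector) \<Rightarrow> 'w set set" where
  "vm_null_sets M \<eta> = {A \<in> sets M. \<forall>B\<in>sets M. B \<subseteq> A \<longrightarrow> \<eta> B = 0}"

definition has_vm_integral ::
  "'w measure \<Rightarrow> ('w set \<Rightarrow> 'a::real_normed_vector) \<Rightarrow> 'w set \<Rightarrow> ('w \<Rightarrow> real) \<Rightarrow> 'a \<Rightarrow> bool" where
  "has_vm_integral M \<eta> A f z \<longleftrightarrow>
     (\<forall>z' :: 'a \<Rightarrow>\<^sub>L real. blinfun_apply z' z = signed_set_integral M (blinfun_apply z' \<circ> \<eta>) A f)"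

definition vm_integral ::
  "'w measure \<Rightarrow> ('w set \<Rightarrow> 'a::real_normed_vector) \<Rightarrow> 'w set \<Rightarrow> ('w \<Rightarrow> real) \<Rightarrow> 'a" where
  "vm_integral M \<eta> A f = (THE z. has_vm_integral M \<eta> A f z)"

definition vm_integrable ::
  "'w measure \<Rightarrow> ('w set \<Rightarrow> 'a::real_normed_vector) \<Rightarrow> ('w \<Rightarrow> real) \<Rightarrow> bool" where
  "vm_integrable M \<eta> f \<longleftrightarrow>
     f \<in> borel_measurable M \<and>
     (\<forall>z' :: 'a \<Rightarrow>\<^sub>L real. integrable (variation_measure M (blinfun_apply z' \<circ> \<eta>)) f) \<and>
     (\<forall>A\<in>sets M. \<exists>z. has_vm_integral M \<eta> A f z)"

definition vm_ae_eq ::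
  "'w measure \<Rightarrow> ('w set \<Rightarrow> 'a::real_normed_vector) \<Rightarrow> (('w \<Rightarrow> real) \<times> ('w \<Rightarrow> real)) set" where
  "vm_ae_eq M \<eta> = {(f, g). vm_integrable M \<eta> f \<and> vm_integrable M \<eta> g \<and>
                           {x \<in> space M. f x \<noteq> g x} \<in> vm_null_sets M \<eta>}"

text \<open>
  Elements of \<open>L\<^sub>1(\<eta>)\<close> are equivalence classes; the norm and the integration operator on a class
  are the common value on its representatives.
\<close>

definition L1 :: "'w measure \<Rightarrow> ('w set \<Rightarrow> 'a::real_normed_vector) \<Rightarrow> ('w \<Rightarrow> real) set set" where
  "L1 M \<eta> = Collect (vm_integrable M \<eta>) // vm_ae_eq M \<eta>"

definition L1_norm ::
  "'w measure \<Rightarrow> ('w set \<Rightarrow> 'a::real_normed_vector) \<Rightarrow> ('w \<Rightarrow> real) set \<Rightarrow> real" where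
  "L1_norm M \<eta> F = the_elem
     ((\<lambda>f. SUP z'\<in>cball (0 :: 'a \<Rightarrow>\<^sub>L real) 1.
             integral\<^sup>L (variation_measure M (blinfun_apply z' \<circ> \<eta>)) (\<lambda>x. \<bar>f x\<bar>)) ` F)"

definition integration_op ::
  "'w measure \<Rightarrow> ('w set \<Rightarrow> 'a::real_normed_vector) \<Rightarrow> ('w \<Rightarrow> real) set \<Rightarrow> 'a" where
  "integration_op M \<eta> F = the_elem (vm_integral M \<eta> (space M) ` F)"

end

theory Submission imports Defs begin

text \<open>
  The Orlicz-Thomas property of \<open>T\<^sup>*(B)\<close>, where \<open>B\<close> is the dual unit ball, has two consequences: \<open>T\<close> is
  injective, and a set function \<open>\<theta>\<close> is countably additive as soon as \<open>y \<circ> T \<circ> \<theta>\<close> is, for every functional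
  \<open>y\<close> in \<open>B\<close>. For a \<open>\<nu>\<close>-integrable \<open>f\<close>, the range condition allows one to define \<open>\<theta> A\<close> by
  \<open>T (\<theta> A) = \<integral>\<^sub>A f d\<nu>\<close>, and \<open>\<theta>\<close> is then countably additive. With \<open>f = 1\<close> this gives the lifted measure
  \<open>\<nu>'\<close>; injectivity of \<open>T\<close> shows that \<open>\<nu>\<close> and \<open>\<nu>'\<close> have the same null sets.

  That a \<open>\<nu>'\<close>-integrable function is \<open>\<nu>\<close>-integrable is immediate by applying \<open>T\<close>. Conversely, let
  \<open>f\<close> be \<open>\<nu>\<close>-integrable and \<open>\<theta>\<close> as above. Bounded functions are integrable with respect to any
  countably additive measure (\<open>bounded_has_vm_integral\<close>), so that \<open>\<theta> A = \<integral>\<^sub>A f d\<nu>'\<close> whenever \<open>f\<close> is bounded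
  on \<open>A\<close>. Since \<open>\<theta>\<close> is bounded (\<open>ca_bounded\<close>) and countably additive, it follows that \<open>f\<close> is
  \<open>\<nu>'\<close>-integrable with indefinite integral \<open>\<theta>\<close> (\<open>integrable_if_truncations_extend\<close>).

  For the norms, the norm of \<open>L\<^sub>1(\<eta>)\<close> is compared with the supremum over \<open>A\<close> of the norms of
  \<open>\<integral>\<^sub>A f d\<eta>\<close>, up to a factor \<open>2\<close> (\<open>vm_norm_bounds\<close>). One estimate is then boundedness of \<open>T\<close>, and the
  other is a closed graph argument, carried out directly with a series (\<open>vm_norm_lift_le\<close>).
\<close>

section \<open>Norming functionals\<close>

text \<open>
  The Hahn-Banach theorem is needed only for functionals of norm at most one on a normed space.
  It is obtained from the subadditive, positively homogeneous functionals dominated by the norm: a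
  pointwise minimal one is linear.
\<close>

definition norm_sublinear :: "('a::real_normed_vector \<Rightarrow> real) \<Rightarrow> bool" where
  "norm_sublinear p \<longleftrightarrow> (\<forall>x y. p (x + y) \<le> p x + p y) \<and>
     (\<forall>c x. 0 \<le> c \<longrightarrow> p (c *\<^sub>R x) = c * p x) \<and> (\<forall>x. p x \<le> norm x)"

lemma norm_sublinearD:
  assumes "norm_sublinear p"
  shows "p (x + y) \<le> p x + p y" "0 \<le> c \<Longrightarrow> p (c *\<^sub>R x) = c * p x" "p x \<le> norm x"
    "p 0 = 0" "- p (- x) \<le> p x" "- norm x \<le> p x"
proof -
  show *: "p (x + y) \<le> p x + p y" "0 \<le> c \<Longrightarrow> p (c *\<^sub>R x) = c * p x" "p x \<le> norm x" for x y c
    using assms unfolding norm_sublinear_def by auto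
  show 0: "p 0 = 0" using *(2)[of 0 0] by simp
  show 1: "- p (- x) \<le> p x" using *(1)[of x "-x"] 0 by simp
  show "- norm x \<le> p x" using 1 *(3)[of "-x"] by simp
qed

text \<open>
  Any \<open>p\<close> can be lowered so that its value at \<open>- y\<close> is at most \<open>- p y\<close>. For minimal \<open>p\<close> this gives
  \<open>p (- y) = - p y\<close>, hence linearity; for \<open>p\<close> the norm it provides the starting point below which a
  minimal functional norms \<open>y\<close> up to sign.
\<close>

lemma norm_sublinear_tilt:
  assumes p: "norm_sublinear p"
  obtains q where "norm_sublinear q" "\<And>x. q x \<le> p x" "q (- y) \<le> - p y"
proof -
  note D = norm_sublinearD[OF p]
  \<comment> \<open>The infimum below is finite, because subadditivity of \<open>p\<close> bounds \<open>g x t\<close> by \<open>- p (- x)\<close>.\<close>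
  define g where "g x t = p (x + t *\<^sub>R y) - t * p y" for x t
  define q where "q x = (INF t\<in>{0..}. g x t)" for x
  have lower: "- p (- x) \<le> g x t" if "0 \<le> t" for x t
    using D(1)[of "x + t *\<^sub>R y" "- x"] D(2)[OF that, of y] by (simp add: g_def)
  have le: "q x \<le> g x t" if "0 \<le> t" for x t
    unfolding q_def using that lower by (intro cINF_lower bdd_belowI2[where m = "- p (- x)"]) auto
  have ge: "m \<le> q x" if "\<And>t. 0 \<le> t \<Longrightarrow> m \<le> g x t" for m x
    unfolding q_def using that by (intro cINF_greatest) auto
  have qp: "q x \<le> p x" for x
    using le[of 0 x] by (simp add: g_def)
  have add: "q (x + x') \<le> q x + q x'" for x x'
  proof -
    have *: "q (x + x') \<le> g x s + g x' t" if "0 \<le> s" "0 \<le> t" for s t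
    proof -
      have "q (x + x') \<le> g (x + x') (s + t)" using that by (intro le) auto
      also have "\<dots> \<le> g x s + g x' t"
        using D(1)[of "x + s *\<^sub>R y" "x' + t *\<^sub>R y"]
        by (simp add: g_def algebra_simps)
      finally show ?thesis .
    qed
    have "q (x + x') - q x' \<le> g x s" if "0 \<le> s" for s
    proof -
      have "q (x + x') - g x s \<le> q x'"
        using *[OF that] by (intro ge) (auto simp: algebra_simps)
      then show ?thesis by simp
    qed
    then have "q (x + x') - q x' \<le> q x" by (rule ge)
    then show ?thesis by simp
  qed
  have scale: "q (c *\<^sub>R x) \<le> c * q x" if "0 < c" for c x
  proof -
    have "q (c *\<^sub>R x) / c \<le> g x t" if "0 \<le> t" for t
    proof -
      have "q (c *\<^sub>R x) \<le> g (c *\<^sub>R x) (c * t)" using that \<open>0 < c\<close> by (intro le) auto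
      also have "\<dots> = c * g x t"
        using D(2)[of c "x + t *\<^sub>R y"] \<open>0 < c\<close> by (simp add: g_def algebra_simps)
      finally show ?thesis using \<open>0 < c\<close> by (simp add: field_simps)
    qed
    then have "q (c *\<^sub>R x) / c \<le> q x" by (rule ge)
    then show ?thesis using that by (simp add: field_simps)
  qed
  have q0: "q 0 = 0"
    by (rule antisym[OF order_trans[OF qp] ge]) (auto simp: g_def D)
  have "norm_sublinear q"
    unfolding norm_sublinear_def
  proof (intro conjI allI impI)
    show "q (c *\<^sub>R x) = c * q x" if "0 \<le> c" for c x
    proof (cases "c = 0")
      case False
      then have c: "0 < c" using that by simp
      have "q x \<le> inverse c * q (c *\<^sub>R x)" using scale[of "inverse c" "c *\<^sub>R x"] c by simp
      then have "c * q x \<le> q (c *\<^sub>R x)" using c by (simp add: field_simps)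
      with scale[OF c] show ?thesis by (intro antisym)
    qed (simp add: q0)
    show "q x \<le> norm x" for x using qp[of x] D(3)[of x] by simp
  qed (rule add)
  moreover have "q (- y) \<le> - p y"
    using le[of 1 "- y"] by (simp add: g_def D)
  ultimately show thesis using qp that by blast
qed

text \<open>
  Zorn's lemma for the reversed pointwise order; the infimum of a chain of such functionals is
  again one, being bounded below by \<open>- norm x\<close>.
\<close>

lemma norm_sublinear_minimal:
  assumes q: "norm_sublinear q"
  obtains f where "norm_sublinear f" "\<And>x. f x \<le> q x"
    "\<And>p. norm_sublinear p \<Longrightarrow> (\<And>x. p x \<le> f x) \<Longrightarrow> p = f"
proof -
  define S where "S = {p. norm_sublinear p \<and> p \<le> q}"
  have "\<exists>m\<in>S. \<forall>a\<in>S. a \<le> m \<longrightarrow> a = m"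
  proof (rule predicate_Zorn[where P = "\<lambda>a b. b \<le> a"])
    show "partial_order_on S (relation_of (\<lambda>a b. b \<le> a) S)"
      by (intro partial_order_on_relation_ofI) auto
    fix C assume C: "C \<in> Chains (relation_of (\<lambda>a b. b \<le> a) S)"
    have CS: "C \<subseteq> S" and chain: "\<And>a b. a \<in> C \<Longrightarrow> b \<in> C \<Longrightarrow> a \<le> b \<or> b \<le> a"
      using C unfolding Chains_def relation_of_def by auto
    show "\<exists>u\<in>S. \<forall>a\<in>C. u \<le> a"
    proof (cases "C = {}")
      case True
      then show ?thesis using q unfolding S_def by auto
    next
      case False
      have CD: "norm_sublinear p" if "p \<in> C" for p using that CS unfolding S_def by auto
      define u where "u x = (INF p\<in>C. p x)" for x
      have le: "u x \<le> p x" if "p \<in> C" for p x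
        unfolding u_def using that norm_sublinearD(6)[OF CD]
        by (intro cINF_lower bdd_belowI2[where m = "- norm x"]) auto
      have ge: "m \<le> u x" if "\<And>p. p \<in> C \<Longrightarrow> m \<le> p x" for m x
        unfolding u_def using that False by (intro cINF_greatest) auto
      have "norm_sublinear u"
        unfolding norm_sublinear_def
      proof (intro conjI allI impI)
        fix x y
        have *: "u (x + y) \<le> p x + p' y" if pp: "p \<in> C" "p' \<in> C" for p p'
        proof -
          obtain r where r: "r \<in> C" "r \<le> p" "r \<le> p'" using chain[OF pp] pp by blast
          have "u (x + y) \<le> r x + r y"
            using le[OF r(1), of "x + y"] norm_sublinearD(1)[OF CD[OF r(1)], of x y] by simp
          also have "\<dots> \<le> p x + p' y" using r by (auto simp: le_fun_def intro!: add_mono)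
          finally show ?thesis .
        qed
        have "u (x + y) - u y \<le> p x" if "p \<in> C" for p
        proof -
          have "u (x + y) - p x \<le> u y" using *[OF that] by (intro ge) (auto simp: algebra_simps)
          then show ?thesis by simp
        qed
        then have "u (x + y) - u y \<le> u x" by (rule ge)
        then show "u (x + y) \<le> u x + u y" by simp
      next
        fix c :: real and x assume c: "0 \<le> c"
        show "u (c *\<^sub>R x) = c * u x"
        proof (cases "c = 0")
          case True
          obtain p where "p \<in> C" using False by blast
          then have "u 0 = 0"
            using le[of p 0] ge[of 0 0] norm_sublinearD(4)[OF CD] by (metis antisym order_refl)
          then show ?thesis using True by simp
        next
          case False
          with c have c: "0 < c" by simp
          have "u (c *\<^sub>R x) / c \<le> u x"
          proof (rule ge)
            fix p assume p: "p \<in> C"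
            show "u (c *\<^sub>R x) / c \<le> p x"
              using le[OF p, of "c *\<^sub>R x"] norm_sublinearD(2)[OF CD[OF p], of c x] c
              by (simp add: field_simps)
          qed
          moreover have "c * u x \<le> u (c *\<^sub>R x)"
          proof (rule ge)
            fix p assume p: "p \<in> C"
            have "c * u x \<le> c * p x" using le[OF p] c by (intro mult_left_mono) auto
            then show "c * u x \<le> p (c *\<^sub>R x)" using norm_sublinearD(2)[OF CD[OF p]] c by simp
          qed
          ultimately show ?thesis using c by (simp add: field_simps)
        qed
      next
        fix x
        obtain p where "p \<in> C" using False by blast
        then show "u x \<le> norm x" using le[of p x] norm_sublinearD(3)[OF CD, of p x] by simp
      qed
      moreover have "u \<le> q"
      proof -
        obtain p where "p \<in> C" using False by blast
        then have "p \<le> q" "u \<le> p" using CS le by (auto simp: S_def le_fun_def)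
        then show ?thesis by (rule order_trans[rotated])
      qed
      ultimately show ?thesis using le unfolding S_def le_fun_def by blast
    qed
  qed
  then obtain m where m: "m \<in> S" "\<And>a. a \<in> S \<Longrightarrow> a \<le> m \<Longrightarrow> a = m" by blast
  show thesis
  proof (rule that)
    show "norm_sublinear m" "m x \<le> q x" for x using m(1) by (auto simp: S_def le_fun_def)
    show "p = m" if "norm_sublinear p" "\<And>x. p x \<le> m x" for p
      using m(2)[of p] m(1) that by (auto simp: S_def le_fun_def intro: order_trans)
  qed
qed

proposition norming_functional:
  fixes z :: "'a::real_normed_vector"
  obtains f :: "'a \<Rightarrow>\<^sub>L real" where "norm f \<le> 1" "blinfun_apply f z = norm z"
proof -
  have "norm_sublinear (norm :: 'a \<Rightarrow> real)"
    by (simp add: norm_sublinear_def norm_triangle_ineq)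
  \<comment> \<open>Tilting towards \<open>- z\<close> makes the minimal functional take the value \<open>- norm z\<close> at \<open>z\<close>.\<close>
  then obtain q where q: "norm_sublinear q" "q z \<le> - norm z"
    using norm_sublinear_tilt[of norm "- z"] by auto
  obtain f where f: "norm_sublinear f" "\<And>x. f x \<le> q x"
    and min: "\<And>p. norm_sublinear p \<Longrightarrow> (\<And>x. p x \<le> f x) \<Longrightarrow> p = f"
    using norm_sublinear_minimal[OF q(1)] by metis
  note D = norm_sublinearD[OF f(1)]
  have neg: "f (- y) = - f y" for y
  proof -
    obtain p where "norm_sublinear p" "\<And>x. p x \<le> f x" "p (- y) \<le> - f y"
      using norm_sublinear_tilt[OF f(1)] by metis
    then have "f (- y) \<le> - f y" using min by blast
    moreover have "- f y \<le> f (- y)" using D(5)[of "-y"] by simp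
    ultimately show ?thesis by simp
  qed
  have add: "f (x + y) = f x + f y" for x y
    using D(1)[of x y] D(1)[of "-x" "-y"] neg[of "x + y"] neg[of x] neg[of y] by simp
  have scale: "f (c *\<^sub>R x) = c * f x" for c x
    using D(2)[of c x] D(2)[of "-c" x] neg[of "c *\<^sub>R x"] by (cases "0 \<le> c") auto
  have bound: "\<bar>f x\<bar> \<le> norm x" for x
    using D(3)[of x] D(6)[of x] by (simp add: abs_le_iff)
  have bl: "bounded_linear (\<lambda>x. - f x)"
    by (rule bounded_linear_intro[where K = 1]) (auto simp: add scale bound)
  show thesis
  proof (rule that)
    show "norm (Blinfun (\<lambda>x. - f x)) \<le> 1"
      by (rule norm_blinfun_bound) (auto simp: bounded_linear_Blinfun_apply[OF bl] bound)
    have "f z \<le> - norm z" using f(2)[of z] q(2) by simp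
    then show "blinfun_apply (Blinfun (\<lambda>x. - f x)) z = norm z"
      using D(6)[of z] by (simp add: bounded_linear_Blinfun_apply[OF bl])
  qed
qed

lemma functionals_separate:
  fixes z w :: "'a::real_normed_vector"
  assumes "\<And>f :: 'a \<Rightarrow>\<^sub>L real. blinfun_apply f z = blinfun_apply f w"
  shows "z = w"
proof -
  obtain f :: "'a \<Rightarrow>\<^sub>L real" where "blinfun_apply f (z - w) = norm (z - w)"
    using norming_functional by blast
  then show ?thesis using assms[of f] by (simp add: blinfun.diff_right)
qed

lemma norm_le_if_functionals_le:
  fixes z :: "'a::real_normed_vector"
  assumes "\<And>f :: 'a \<Rightarrow>\<^sub>L real. norm f \<le> 1 \<Longrightarrow> \<bar>blinfun_apply f z\<bar> \<le> K"
  shows "norm z \<le> K"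
  using norming_functional[of z] assms by (metis abs_of_nonneg norm_ge_zero)

section \<open>Countably additive measures are bounded\<close>

lemma ca_empty:
  assumes "\<eta> \<in> ca M"
  shows "\<eta> {} = 0"
proof -
  have "(\<lambda>n::nat. \<eta> {}) sums \<eta> {}"
    using caD[OF assms, of "\<lambda>_. {}"] by (simp add: disjoint_family_on_def)
  then have "(\<lambda>n::nat. \<eta> {}) \<longlonglongrightarrow> 0"
    by (intro summable_LIMSEQ_zero sums_summable)
  then show ?thesis by (simp add: LIMSEQ_const_iff)
qed

lemma ca_Un:
  assumes "\<eta> \<in> ca M" "A \<in> sets M" "B \<in> sets M" "A \<inter> B = {}"
  shows "\<eta> (A \<union> B) = \<eta> A + \<eta> B"
proof -
  have "(\<lambda>n. \<eta> (binaryset A B n)) sums \<eta> (\<Union>n. binaryset A B n)"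
    using assms by (intro caD) (auto simp: range_binaryset_eq disjoint_family_on_def binaryset_def)
  then show ?thesis
    using binaryset_sums[of \<eta> A B, OF ca_empty[OF assms(1)]] sums_unique2
    by (fastforce simp: UN_binaryset_eq)
qed

lemma ca_Diff:
  assumes "\<eta> \<in> ca M" "A \<in> sets M" "B \<in> sets M" "B \<subseteq> A"
  shows "\<eta> (A - B) = \<eta> A - \<eta> B"
proof -
  have "B \<union> (A - B) = A" using assms(4) by blast
  then show ?thesis using ca_Un[OF assms(1,3), of "A - B"] assms(2,3) by auto
qed

lemma ca_functional:
  assumes "\<eta> \<in> ca M"
  shows "blinfun_apply f \<circ> \<eta> \<in> ca M"
  using assms bounded_linear.sums[OF blinfun.bounded_linear_right[of f]]
  unfolding ca_def by fastforce

lemma ca_cong: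
  assumes "\<eta> \<in> ca M" "\<And>A. A \<in> sets M \<Longrightarrow> \<eta> A = \<theta> A"
  shows "\<theta> \<in> ca M"
  unfolding ca_def
proof (intro CollectI allI impI)
  fix A :: "nat \<Rightarrow> _" assume A: "range A \<subseteq> sets M" "disjoint_family A"
  then have "\<theta> (A n) = \<eta> (A n)" "\<theta> (\<Union>n. A n) = \<eta> (\<Union>n. A n)" for n
    using assms(2) by (metis range_subsetD) (metis A(1) assms(2) sets.countable_UN)
  then show "(\<lambda>n. \<theta> (A n)) sums \<theta> (\<Union>n. A n)"
    using caD[OF assms(1) A] by simp
qed

text \<open>
  If \<open>\<eta>\<close> is unbounded on the measurable subsets of \<open>A\<close>, then \<open>A\<close> splits into two pieces, both with
  values of norm larger than one, and \<open>\<eta>\<close> is still unbounded on the subsets of one of them. Iterating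
  on that piece, the discarded pieces are disjoint and contradict convergence of the series of their
  values. No uniform boundedness principle is involved.
\<close>
proposition ca_bounded:
  assumes \<eta>: "\<eta> \<in> ca M"
  obtains K where "\<And>A. A \<in> sets M \<Longrightarrow> norm (\<eta> A) \<le> K"
proof -
  define big where
    "big A \<longleftrightarrow> A \<in> sets M \<and> (\<forall>K. \<exists>B\<in>sets M. B \<subseteq> A \<and> K < norm (\<eta> B))" for A
  have not_big: "\<exists>K. \<forall>B\<in>sets M. B \<subseteq> A \<longrightarrow> norm (\<eta> B) \<le> K" if "\<not> big A" "A \<in> sets M" for A
    using that unfolding big_def not_less[symmetric] by auto
  have "\<not> big (space M)"
  proof
    assume start: "big (space M)"
    have step: "\<exists>A'. big A' \<and> A' \<subseteq> A \<and> 1 < norm (\<eta> (A - A'))" if "big A" for A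
    proof -
      have A: "A \<in> sets M" using that by (simp add: big_def)
      obtain B where B: "B \<in> sets M" "B \<subseteq> A" "norm (\<eta> A) + 1 < norm (\<eta> B)"
        using \<open>big A\<close> unfolding big_def by blast
      have "norm (\<eta> B) \<le> norm (\<eta> A) + norm (\<eta> (A - B))"
        using norm_triangle_ineq4[of "\<eta> A" "\<eta> (A - B)"] ca_Diff[OF \<eta> A B(1,2)] by simp
      then have 1: "1 < norm (\<eta> (A - B))" "1 < norm (\<eta> (A - (A - B)))"
        using B(3) norm_ge_zero[of "\<eta> A"] unfolding double_diff[OF B(2) order_refl]
        by linarith+
      have "big B \<or> big (A - B)"
      proof (rule ccontr)
        assume "\<not> ?thesis"
        then have small: "\<not> big B" "\<not> big (A - B)" by auto
        obtain K where K: "\<forall>C\<in>sets M. C \<subseteq> B \<longrightarrow> norm (\<eta> C) \<le> K"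
          using not_big[OF small(1) B(1)] by blast
        obtain L where L: "\<forall>C\<in>sets M. C \<subseteq> A - B \<longrightarrow> norm (\<eta> C) \<le> L"
          using not_big[OF small(2)] A B(1) by blast
        obtain C where C: "C \<in> sets M" "C \<subseteq> A" "K + L < norm (\<eta> C)"
          using \<open>big A\<close> unfolding big_def by blast
        have "\<eta> ((C \<inter> B) \<union> (C - B)) = \<eta> (C \<inter> B) + \<eta> (C - B)"
          using C B by (intro ca_Un[OF \<eta>]) auto
        moreover have "(C \<inter> B) \<union> (C - B) = C" by blast
        ultimately have "norm (\<eta> C) \<le> norm (\<eta> (C \<inter> B)) + norm (\<eta> (C - B))"
          using norm_triangle_ineq by metis
        also have "\<dots> \<le> K + L"
          using C B by (intro add_mono K[rule_format] L[rule_format]) auto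
        finally show False using C(3) by simp
      qed
      then show ?thesis using 1 B(2) by blast
    qed
    obtain S where S: "\<And>n. big (S n)" "\<And>n. S (Suc n) \<subseteq> S n" "\<And>n. 1 < norm (\<eta> (S n - S (Suc n)))"
    proof -
      have "\<exists>S. \<forall>n::nat. big (S n) \<and> S (Suc n) \<subseteq> S n \<and> 1 < norm (\<eta> (S n - S (Suc n)))"
        by (rule dependent_nat_choice) (use start step in auto)
      then show thesis using that by blast
    qed
    have dec: "S n \<subseteq> S m" if "m \<le> n" for m n
      using S(2) that by (rule lift_Suc_antimono_le)
    have "disjoint_family (\<lambda>n. S n - S (Suc n))"
      unfolding disjoint_family_on_def
    proof (intro ballI impI)
      have "(S m - S (Suc m)) \<inter> (S n - S (Suc n)) = {}" if "m < n" for m n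
        using dec[of "Suc m" n] that by auto
      then show "(S m - S (Suc m)) \<inter> (S n - S (Suc n)) = {}" if "m \<noteq> n" for m n
        using that by (metis inf_commute nat_neq_iff)
    qed
    then have "(\<lambda>n. \<eta> (S n - S (Suc n))) sums \<eta> (\<Union>n. S n - S (Suc n))"
      using S(1) by (intro caD[OF \<eta>]) (auto simp: big_def)
    then have "(\<lambda>n. norm (\<eta> (S n - S (Suc n)))) \<longlonglongrightarrow> 0"
      by (intro tendsto_norm_zero summable_LIMSEQ_zero sums_summable)
    then have "1 \<le> (0::real)"
      using S(3) by (intro LIMSEQ_le_const) (auto intro: less_imp_le)
    then show False by simp
  qed
  then obtain K where K: "\<forall>A\<in>sets M. A \<subseteq> space M \<longrightarrow> norm (\<eta> A) \<le> K"
    using not_big[of "space M"] by auto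
  show thesis
    by (rule that[of K]) (use K sets.sets_into_space in blast)
qed

section \<open>The Jordan decomposition\<close>

lemma sets_positive_part [simp, measurable_cong]: "sets (positive_part_measure M \<mu>) = sets M"
  by (simp add: positive_part_measure_def)

lemma space_positive_part [simp]: "space (positive_part_measure M \<mu>) = space M"
  by (simp add: positive_part_measure_def)

lemma sets_variation [simp, measurable_cong]: "sets (variation_measure M \<mu>) = sets M"
  by (simp add: variation_measure_def)

lemma space_variation [simp]: "space (variation_measure M \<mu>) = space M"
  by (simp add: variation_measure_def)

lemma ca_uminus:
  fixes \<mu> :: "'w set \<Rightarrow> real"
  shows "\<mu> \<in> ca M \<Longrightarrow> (\<lambda>A. - \<mu> A) \<in> ca M"
  unfolding ca_def using sums_minus by blast

text \<open>
  The supremum in the definition of the positive part is superadditive on disjoint sets, because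
  subsets of disjoint sets can be united; countable subadditivity follows from that of
  \<open>ennreal\<close> applied to \<open>\<mu> B = (\<Sum>i. \<mu> (B \<inter> A i))\<close>.
\<close>
lemma emeasure_positive_part:
  fixes \<mu> :: "'w set \<Rightarrow> real"
  assumes \<mu>: "\<mu> \<in> ca M" and "A \<in> sets M"
  shows "emeasure (positive_part_measure M \<mu>) A = (SUP B\<in>{B\<in>sets M. B \<subseteq> A}. ennreal (\<mu> B))"
proof -
  define pos where "pos A = (SUP B\<in>{B\<in>sets M. B \<subseteq> A}. ennreal (\<mu> B))" for A
  have upper: "ennreal (\<mu> B) \<le> pos A" if "B \<in> sets M" "B \<subseteq> A" for A B
    unfolding pos_def using that by (intro SUP_upper) auto
  have least: "pos A \<le> m" if "\<And>B. B \<in> sets M \<Longrightarrow> B \<subseteq> A \<Longrightarrow> ennreal (\<mu> B) \<le> m" for A m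
    unfolding pos_def using that by (intro SUP_least) auto
  have mono: "pos A \<le> pos B" if "A \<subseteq> B" for A B
    using that by (intro least upper) auto
  have super: "pos A + pos B \<le> pos (A \<union> B)" if "A \<inter> B = {}" for A B
  proof -
    have *: "ennreal (\<mu> C) + ennreal (\<mu> D) \<le> pos (A \<union> B)"
      if "C \<in> sets M" "C \<subseteq> A" "D \<in> sets M" "D \<subseteq> B" for C D
    \<comment> \<open>\<^const>\<open>ennreal\<close> sends a negative value to \<open>0\<close>, so a set of negative measure can be dropped.\<close>
    proof (cases "0 \<le> \<mu> C \<and> 0 \<le> \<mu> D")
      case True
      have "\<mu> (C \<union> D) = \<mu> C + \<mu> D"
        using that \<open>A \<inter> B = {}\<close> by (intro ca_Un[OF \<mu>]) auto
      then have "ennreal (\<mu> C) + ennreal (\<mu> D) = ennreal (\<mu> (C \<union> D))"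
        using True by (simp add: ennreal_plus)
      also have "\<dots> \<le> pos (A \<union> B)" using that by (intro upper) auto
      finally show ?thesis .
    next
      case False
      then show ?thesis
        using upper[of C "A \<union> B"] upper[of D "A \<union> B"] that
        by (auto simp: not_le ennreal_neg le_supI1 le_supI2)
    qed
    have ne: "{C\<in>sets M. C \<subseteq> X} \<noteq> {}" for X using sets.empty_sets by blast
    have "pos A + ennreal (\<mu> D) \<le> pos (A \<union> B)" if "D \<in> sets M" "D \<subseteq> B" for D
      unfolding pos_def[of A] using * that
      by (subst ennreal_SUP_add_left[symmetric, OF ne]) (auto intro!: SUP_least)
    then show ?thesis
      unfolding pos_def[of B]
      by (subst ennreal_SUP_add_right[OF ne]) (auto intro!: SUP_least)
  qed
  have "countably_additive (sets M) pos"
  proof (rule countably_additiveI)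
    fix A :: "nat \<Rightarrow> 'w set"
    assume A: "range A \<subseteq> sets M" "disjoint_family A" "(\<Union>i. A i) \<in> sets M"
    show "(\<Sum>i. pos (A i)) = pos (\<Union>i. A i)"
    proof (rule antisym)
      have "(\<Sum>i<n. pos (A i)) \<le> pos (\<Union>i<n. A i)" for n
      proof (induction n)
        case (Suc n)
        have "(\<Sum>i<Suc n. pos (A i)) \<le> pos (\<Union>i<n. A i) + pos (A n)"
          using Suc by (simp add: add_right_mono)
        also have "\<dots> \<le> pos ((\<Union>i<n. A i) \<union> A n)"
        proof (rule super)
          have "A i \<inter> A n = {}" if "i < n" for i
            using A(2) that by (simp add: disjoint_family_on_def)
          then show "(\<Union>i<n. A i) \<inter> A n = {}" by auto
        qed
        also have "(\<Union>i<n. A i) \<union> A n = (\<Union>i<Suc n. A i)" by (auto simp: less_Suc_eq)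
        finally show ?case .
      qed simp
      then have "(\<Sum>i<n. pos (A i)) \<le> pos (\<Union>i. A i)" for n
        using mono[of "\<Union>i<n. A i" "\<Union>i. A i"] by (force intro: order_trans)
      then show "(\<Sum>i. pos (A i)) \<le> pos (\<Union>i. A i)"
        by (intro suminf_le_const) auto
      show "pos (\<Union>i. A i) \<le> (\<Sum>i. pos (A i))"
      proof (rule least)
        fix B assume B: "B \<in> sets M" "B \<subseteq> (\<Union>i. A i)"
        have "(\<lambda>i. \<mu> (B \<inter> A i)) sums \<mu> (\<Union>i. B \<inter> A i)"
          using A B by (intro caD[OF \<mu>]) (auto simp: disjoint_family_on_def)
        moreover have "(\<Union>i. B \<inter> A i) = B" using B(2) by blast
        ultimately have "(\<lambda>n. ennreal (\<Sum>i<n. \<mu> (B \<inter> A i))) \<longlonglongrightarrow> ennreal (\<mu> B)"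
          by (auto simp: sums_def intro: tendsto_ennrealI)
        moreover have "ennreal (\<Sum>i<n. \<mu> (B \<inter> A i)) \<le> (\<Sum>i. pos (A i))" for n
        proof -
          have "ennreal (\<Sum>i<n. \<mu> (B \<inter> A i)) \<le> (\<Sum>i<n. ennreal (\<mu> (B \<inter> A i)))"
          proof (induction n)
            case (Suc n)
            have "ennreal (a + b) \<le> ennreal a + ennreal b" for a b
              by (cases "0 \<le> a"; cases "0 \<le> b")
                 (auto simp: ennreal_plus ennreal_neg not_le intro!: ennreal_leI)
            then show ?case using Suc
              by (simp add: add_right_mono order_trans)
                 (meson add_right_mono order_trans)
          qed simp
          also have "\<dots> \<le> (\<Sum>i<n. pos (A i))"
            using A B by (intro sum_mono upper) auto
          also have "\<dots> \<le> (\<Sum>i. pos (A i))" by (intro sum_le_suminf) auto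
          finally show ?thesis .
        qed
        ultimately show "ennreal (\<mu> B) \<le> (\<Sum>i. pos (A i))"
          by (intro LIMSEQ_le_const2) auto
      qed
    qed
  qed
  moreover have "positive (sets M) pos"
    using ca_empty[OF \<mu>] by (auto simp: positive_def pos_def intro!: antisym SUP_least)
  ultimately show ?thesis
    using assms(2) unfolding pos_def
    by (intro emeasure_measure_of[OF positive_part_measure_def])
       (auto simp: sets.space_closed)
qed

lemma finite_measure_positive_part:
  fixes \<mu> :: "'w set \<Rightarrow> real"
  assumes \<mu>: "\<mu> \<in> ca M"
  shows "finite_measure (positive_part_measure M \<mu>)"
proof (rule finite_measureI)
  obtain K where K: "\<And>A. A \<in> sets M \<Longrightarrow> norm (\<mu> A) \<le> K"
    using ca_bounded[OF \<mu>] by blast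
  have "ennreal (\<mu> B) \<le> ennreal K" if "B \<in> sets M" for B
    using K[OF that] by (intro ennreal_leI) auto
  then have "emeasure (positive_part_measure M \<mu>) (space M) \<le> ennreal K"
    by (auto simp: emeasure_positive_part[OF \<mu>] intro!: SUP_least)
  then show "emeasure (positive_part_measure M \<mu>) (space (positive_part_measure M \<mu>)) \<noteq> \<infinity>"
    by (auto simp: top_unique)
qed

lemma measure_positive_part_upper:
  fixes \<mu> :: "'w set \<Rightarrow> real"
  assumes \<mu>: "\<mu> \<in> ca M" and A: "A \<in> sets M" and B: "B \<in> sets M" "B \<subseteq> A"
  shows "\<mu> B \<le> measure (positive_part_measure M \<mu>) A"
proof -
  interpret finite_measure "positive_part_measure M \<mu>" by (rule finite_measure_positive_part[OF \<mu>])
  have "ennreal (\<mu> B) \<le> emeasure (positive_part_measure M \<mu>) A"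
    unfolding emeasure_positive_part[OF \<mu> A] using B by (intro SUP_upper) auto
  then show ?thesis by (simp add: emeasure_eq_measure)
qed

lemma measure_positive_part_least:
  fixes \<mu> :: "'w set \<Rightarrow> real"
  assumes \<mu>: "\<mu> \<in> ca M" and A: "A \<in> sets M"
    and m: "\<And>B. B \<in> sets M \<Longrightarrow> B \<subseteq> A \<Longrightarrow> \<mu> B \<le> m"
  shows "measure (positive_part_measure M \<mu>) A \<le> m"
proof -
  interpret finite_measure "positive_part_measure M \<mu>" by (rule finite_measure_positive_part[OF \<mu>])
  have "emeasure (positive_part_measure M \<mu>) A \<le> ennreal m"
    unfolding emeasure_positive_part[OF \<mu> A] using m by (auto intro!: SUP_least ennreal_leI)
  moreover have "0 \<le> m" using m[of "{}"] ca_empty[OF \<mu>] by simp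
  ultimately show ?thesis by (simp add: emeasure_eq_measure)
qed

lemma Jordan_decomposition:
  fixes \<mu> :: "'w set \<Rightarrow> real"
  assumes \<mu>: "\<mu> \<in> ca M" and A: "A \<in> sets M"
  shows "\<mu> A = measure (positive_part_measure M \<mu>) A - measure (positive_part_measure M (\<lambda>B. - \<mu> B)) A"
    (is "_ = ?p - ?q")
proof -
  have "?p \<le> \<mu> A + ?q"
  proof (rule measure_positive_part_least[OF \<mu> A])
    fix B assume B: "B \<in> sets M" "B \<subseteq> A"
    show "\<mu> B \<le> \<mu> A + ?q"
      using measure_positive_part_upper[OF ca_uminus[OF \<mu>] A, of "A - B"] ca_Diff[OF \<mu> A B] A B
      by auto
  qed
  moreover have "?q \<le> ?p - \<mu> A"
  proof (rule measure_positive_part_least[OF ca_uminus[OF \<mu>] A])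
    fix B assume B: "B \<in> sets M" "B \<subseteq> A"
    show "- \<mu> B \<le> ?p - \<mu> A"
      using measure_positive_part_upper[OF \<mu> A, of "A - B"] ca_Diff[OF \<mu> A B] A B by auto
  qed
  ultimately show ?thesis by simp
qed

text \<open>
  The Hahn set of the two finite measures \<open>\<mu>\<^sup>+\<close> and \<open>(- \<mu>)\<^sup>+\<close> separates them: on its measurable
  subsets \<open>(- \<mu>)\<^sup>+ \<le> \<mu>\<^sup>+\<close>, so that \<open>\<mu>\<close> is nonnegative there, and \<open>(- \<mu>)\<^sup>+\<close>, a supremum of values
  of \<open>- \<mu>\<close>, vanishes; likewise on the complement with the signs exchanged.
\<close>
lemma Hahn_decomposition:
  fixes \<mu> :: "'w set \<Rightarrow> real"
  assumes \<mu>: "\<mu> \<in> ca M"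
  obtains Y where "Y \<in> sets M"
    "\<And>A. A \<in> sets M \<Longrightarrow> emeasure (positive_part_measure M \<mu>) (A - Y) = 0"
    "\<And>A. A \<in> sets M \<Longrightarrow> emeasure (positive_part_measure M (\<lambda>B. - \<mu> B)) (A \<inter> Y) = 0"
proof -
  let ?P = "positive_part_measure M \<mu>" and ?Q = "positive_part_measure M (\<lambda>B. - \<mu> B)"
  interpret P: finite_measure ?P by (rule finite_measure_positive_part[OF \<mu>])
  interpret Q: finite_measure ?Q by (rule finite_measure_positive_part[OF ca_uminus[OF \<mu>]])
  obtain Y where Y: "Y \<in> sets M"
    "\<And>X. X \<in> sets M \<Longrightarrow> X \<subseteq> Y \<Longrightarrow> ?Q X \<le> ?P X"
    "\<And>X. X \<in> sets M \<Longrightarrow> X \<inter> Y = {} \<Longrightarrow> ?P X \<le> ?Q X"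
    using finite_unsigned_Hahn_decomposition[OF P.finite_measure_axioms Q.finite_measure_axioms] by auto
  show thesis
  proof (rule that[OF Y(1)])
    fix A assume A: "A \<in> sets M"
    have "measure ?P (A - Y) \<le> 0"
    proof (rule measure_positive_part_least[OF \<mu>])
      fix B assume B: "B \<in> sets M" "B \<subseteq> A - Y"
      then show "\<mu> B \<le> 0"
        using Y(3)[of B] Jordan_decomposition[OF \<mu> B(1)]
        by (auto simp: P.emeasure_eq_measure Q.emeasure_eq_measure)
    qed (use A Y in auto)
    then show "?P (A - Y) = 0" by (simp add: P.emeasure_eq_measure ennreal_eq_0_iff)
    have "measure ?Q (A \<inter> Y) \<le> 0"
    proof (rule measure_positive_part_least[OF ca_uminus[OF \<mu>]])
      fix B assume B: "B \<in> sets M" "B \<subseteq> A \<inter> Y"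
      then show "- \<mu> B \<le> 0"
        using Y(2)[of B] Jordan_decomposition[OF \<mu> B(1)]
        by (auto simp: P.emeasure_eq_measure Q.emeasure_eq_measure)
    qed (use A Y in auto)
    then show "?Q (A \<inter> Y) = 0" by (simp add: Q.emeasure_eq_measure ennreal_eq_0_iff)
  qed
qed

lemma emeasure_variation:
  fixes \<mu> :: "'w set \<Rightarrow> real"
  assumes \<mu>: "\<mu> \<in> ca M" and A: "A \<in> sets M"
  shows "emeasure (variation_measure M \<mu>) A =
    emeasure (positive_part_measure M \<mu>) A + emeasure (positive_part_measure M (\<lambda>B. - \<mu> B)) A"
proof -
  let ?P = "positive_part_measure M \<mu>" and ?Q = "positive_part_measure M (\<lambda>B. - \<mu> B)"
  interpret P: finite_measure ?P by (rule finite_measure_positive_part[OF \<mu>])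
  interpret Q: finite_measure ?Q by (rule finite_measure_positive_part[OF ca_uminus[OF \<mu>]])
  have abs: "ennreal \<bar>\<mu> B\<bar> \<le> ?P B + ?Q B" if "B \<in> sets M" for B
  proof -
    have "\<bar>\<mu> B\<bar> \<le> measure ?P B + measure ?Q B"
      using Jordan_decomposition[OF \<mu> that] measure_nonneg[of ?P B] measure_nonneg[of ?Q B] by linarith
    then show ?thesis
      by (simp add: P.emeasure_eq_measure Q.emeasure_eq_measure ennreal_leI flip: ennreal_plus)
  qed
  obtain Y where Y: "Y \<in> sets M"
    "\<And>A. A \<in> sets M \<Longrightarrow> ?P (A - Y) = 0" "\<And>A. A \<in> sets M \<Longrightarrow> ?Q (A \<inter> Y) = 0"
    using Hahn_decomposition[OF \<mu>] by blast
  have eq: "(SUP \<P>\<in>{\<P>. finite \<P> \<and> \<P> \<subseteq> sets M \<and> partition_on B \<P>}. \<Sum>C\<in>\<P>. ennreal \<bar>\<mu> C\<bar>) = ?P B + ?Q B"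
    if B: "B \<in> sets M" for B
  proof (rule antisym)
    show "(SUP \<P>\<in>{\<P>. finite \<P> \<and> \<P> \<subseteq> sets M \<and> partition_on B \<P>}. \<Sum>C\<in>\<P>. ennreal \<bar>\<mu> C\<bar>) \<le> ?P B + ?Q B"
    proof (rule SUP_least, clarify)
      fix \<P> assume \<P>: "finite \<P>" "\<P> \<subseteq> sets M" "partition_on B \<P>"
      then have dis: "disjoint_family_on id \<P>"
        by (auto simp: disjoint_family_on_def partition_on_def disjoint_def)
      have "(\<Sum>C\<in>\<P>. ennreal \<bar>\<mu> C\<bar>) \<le> (\<Sum>C\<in>\<P>. ?P C + ?Q C)"
        using \<P>(2) by (intro sum_mono abs) auto
      also have "\<dots> = ?P (\<Union>C\<in>\<P>. id C) + ?Q (\<Union>C\<in>\<P>. id C)"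
        using \<P> dis sum_emeasure[of id \<P> ?P] sum_emeasure[of id \<P> ?Q] by (simp add: sum.distrib)
      also have "(\<Union>C\<in>\<P>. id C) = B" using \<P>(3) by (auto simp: partition_on_def)
      finally show "(\<Sum>C\<in>\<P>. ennreal \<bar>\<mu> C\<bar>) \<le> ?P B + ?Q B" .
    qed
    have split: "N B = N (B \<inter> Y) + N (B - Y)" if "sets N = sets M" for N
      using B Y(1) that plus_emeasure[of "B \<inter> Y" N "B - Y"] by (simp add: Int_Diff_disjoint Int_Diff_Un)
    have "?P (B \<inter> Y) = ennreal \<bar>\<mu> (B \<inter> Y)\<bar>"
      using Jordan_decomposition[OF \<mu>, of "B \<inter> Y"] B Y(1) Y(3)[OF B]
      by (simp add: P.emeasure_eq_measure Q.emeasure_eq_measure ennreal_eq_0_iff measure_le_0_iff)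
    moreover have "?Q (B - Y) = ennreal \<bar>\<mu> (B - Y)\<bar>"
      using Jordan_decomposition[OF \<mu>, of "B - Y"] B Y(1) Y(2)[OF B]
      by (simp add: P.emeasure_eq_measure Q.emeasure_eq_measure ennreal_eq_0_iff measure_le_0_iff)
    ultimately have "?P B + ?Q B = ennreal \<bar>\<mu> (B \<inter> Y)\<bar> + ennreal \<bar>\<mu> (B - Y)\<bar>"
      using split[of ?P] split[of ?Q] Y(2,3)[OF B] by simp
    \<comment> \<open>The blocks of a partition are nonempty, so an empty piece has to be removed.\<close>
    also have "\<dots> = (\<Sum>C\<in>{B \<inter> Y, B - Y} - {{}}. ennreal \<bar>\<mu> C\<bar>)"
    proof -
      have "(\<Sum>C\<in>{B \<inter> Y, B - Y} - {{}}. ennreal \<bar>\<mu> C\<bar>) = (\<Sum>C\<in>{B \<inter> Y, B - Y}. ennreal \<bar>\<mu> C\<bar>)"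
        using ca_empty[OF \<mu>] by (intro sum.mono_neutral_left) auto
      also have "\<dots> = ennreal \<bar>\<mu> (B \<inter> Y)\<bar> + ennreal \<bar>\<mu> (B - Y)\<bar>"
      proof (cases "B \<inter> Y = B - Y")
        case True
        then have "B = {}" by blast
        then show ?thesis using ca_empty[OF \<mu>] by simp
      qed simp
      finally show ?thesis by simp
    qed
    also have "\<dots> \<le> (SUP \<P>\<in>{\<P>. finite \<P> \<and> \<P> \<subseteq> sets M \<and> partition_on B \<P>}. \<Sum>C\<in>\<P>. ennreal \<bar>\<mu> C\<bar>)"
      using B Y(1) by (intro SUP_upper) (auto simp: partition_on_def disjoint_def)
    finally show "?P B + ?Q B \<le> \<dots>" .
  qed
  have "variation_measure M \<mu> = measure_of (space M) (sets M) (\<lambda>A. ?P A + ?Q A)"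
    unfolding variation_measure_def
    by (intro measure_of_eq sets.space_closed) (simp only: eq sets.sigma_sets_eq)
  then show ?thesis
  proof (rule emeasure_measure_of)
    show "countably_additive (sets (variation_measure M \<mu>)) (\<lambda>A. ?P A + ?Q A)"
      by (rule countably_additiveI) (auto simp: suminf_emeasure simp flip: suminf_add)
  qed (use A sets.sets_into_space in \<open>auto simp: positive_def\<close>)
qed

lemma nn_integral_variation:
  fixes \<mu> :: "'w set \<Rightarrow> real"
  assumes \<mu>: "\<mu> \<in> ca M" and f: "f \<in> borel_measurable M"
  shows "integral\<^sup>N (variation_measure M \<mu>) f =
    integral\<^sup>N (positive_part_measure M \<mu>) f + integral\<^sup>N (positive_part_measure M (\<lambda>B. - \<mu> B)) f"
  using f
proof (induction rule: borel_measurable_induct)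
  case (cong f g)
  then show ?case using nn_integral_cong[of _ f g] by (metis space_positive_part space_variation)
next
  case (set A)
  then show ?case by (simp add: emeasure_variation[OF \<mu>])
next
  case (mult u c)
  then show ?case by (simp add: nn_integral_cmult distrib_left)
next
  case (add u v)
  then show ?case by (simp add: nn_integral_add ac_simps)
next
  case (seq U)
  have eq: "integral\<^sup>N N (SUP i. U i) = (SUP i. integral\<^sup>N N (U i))" if "sets N = sets M" for N
  proof -
    have "Sup (range U) = (\<lambda>x. SUP i. U i x)" by (simp add: fun_eq_iff image_comp)
    then show ?thesis
      using seq that measurable_cong_sets[OF that refl]
      by (simp add: nn_integral_monotone_convergence_SUP)
  qed
  have inc: "incseq (\<lambda>i. integral\<^sup>N N (U i))" for N :: "'w measure"
    using \<open>incseq U\<close> by (auto simp: incseq_def le_fun_def intro!: nn_integral_mono)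
  show ?case
    by (simp only: eq seq.IH ennreal_SUP_add[OF inc inc] sets_variation sets_positive_part)
qed

lemma integrable_variation_iff:
  fixes \<mu> :: "'w set \<Rightarrow> real" and f :: "'w \<Rightarrow> real"
  assumes \<mu>: "\<mu> \<in> ca M"
  shows "integrable (variation_measure M \<mu>) f \<longleftrightarrow>
    integrable (positive_part_measure M \<mu>) f \<and> integrable (positive_part_measure M (\<lambda>B. - \<mu> B)) f"
  by (cases "f \<in> borel_measurable M")
     (auto simp: integrable_iff_bounded nn_integral_variation[OF \<mu>] measurable_cong_sets[OF sets_variation refl]
        measurable_cong_sets[OF sets_positive_part refl])

lemma integral_variation:
  fixes \<mu> :: "'w set \<Rightarrow> real" and f :: "'w \<Rightarrow> real"
  assumes \<mu>: "\<mu> \<in> ca M" and f: "integrable (variation_measure M \<mu>) f" "\<And>x. 0 \<le> f x"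
  shows "integral\<^sup>L (variation_measure M \<mu>) f =
    integral\<^sup>L (positive_part_measure M \<mu>) f + integral\<^sup>L (positive_part_measure M (\<lambda>B. - \<mu> B)) f"
proof -
  have i: "integrable (positive_part_measure M \<mu>) f" "integrable (positive_part_measure M (\<lambda>B. - \<mu> B)) f"
    using f integrable_variation_iff[OF \<mu>] by auto
  have [measurable]: "f \<in> borel_measurable M"
    using borel_measurable_integrable[OF f(1)] by simp
  have "ennreal (integral\<^sup>L (variation_measure M \<mu>) f) = ennreal (integral\<^sup>L (positive_part_measure M \<mu>) f)
     + ennreal (integral\<^sup>L (positive_part_measure M (\<lambda>B. - \<mu> B)) f)"
    using f i by (simp add: nn_integral_variation[OF \<mu>] flip: nn_integral_eq_integral)
  then show ?thesis using f(2)
    by (simp flip: ennreal_plus)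
qed

section \<open>Integration against a signed measure\<close>

lemma positive_part_cong:
  assumes "\<And>A. A \<in> sets M \<Longrightarrow> \<mu> A = \<mu>' A"
  shows "positive_part_measure M \<mu> = positive_part_measure M \<mu>'"
proof -
  have "(SUP B\<in>{B \<in> sets M. B \<subseteq> A}. ennreal (\<mu> B)) = (SUP B\<in>{B \<in> sets M. B \<subseteq> A}. ennreal (\<mu>' B))" for A
    using assms by (intro SUP_cong) auto
  then show ?thesis by (simp add: positive_part_measure_def)
qed

lemma variation_cong:
  assumes "\<And>A. A \<in> sets M \<Longrightarrow> \<mu> A = \<mu>' A"
  shows "variation_measure M \<mu> = variation_measure M \<mu>'"
proof -
  have "(SUP \<P>\<in>{\<P>. finite \<P> \<and> \<P> \<subseteq> sets M \<and> partition_on A \<P>}. \<Sum>B\<in>\<P>. ennreal \<bar>\<mu> B\<bar>) =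
        (SUP \<P>\<in>{\<P>. finite \<P> \<and> \<P> \<subseteq> sets M \<and> partition_on A \<P>}. \<Sum>B\<in>\<P>. ennreal \<bar>\<mu>' B\<bar>)" for A
    using assms by (intro SUP_cong refl sum.cong) auto
  then show ?thesis by (simp add: variation_measure_def)
qed

lemma signed_set_integral_cong_measure:
  assumes "\<And>A. A \<in> sets M \<Longrightarrow> \<mu> A = \<mu>' A"
  shows "signed_set_integral M \<mu> = signed_set_integral M \<mu>'"
  using positive_part_cong[of M \<mu> \<mu>'] positive_part_cong[of M "\<lambda>A. - \<mu> A" "\<lambda>A. - \<mu>' A"] assms
  by (simp add: signed_set_integral_def fun_eq_iff)

lemma signed_set_integral_cmult:
  "signed_set_integral M \<mu> A (\<lambda>x. c * f x) = c * signed_set_integral M \<mu> A f"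
  by (simp add: signed_set_integral_def set_lebesgue_integral_def mult.left_commute[of _ c]
      right_diff_distrib)

lemma signed_set_integral_restrict:
  "signed_set_integral M \<mu> A (\<lambda>x. indicator B x * f x) = signed_set_integral M \<mu> (A \<inter> B) f"
  by (simp add: signed_set_integral_def set_lebesgue_integral_def indicator_inter_arith mult.assoc)

lemma finite_measure_variation:
  fixes \<mu> :: "'w set \<Rightarrow> real"
  assumes \<mu>: "\<mu> \<in> ca M"
  shows "finite_measure (variation_measure M \<mu>)"
proof -
  interpret P: finite_measure "positive_part_measure M \<mu>" by (rule finite_measure_positive_part[OF \<mu>])
  interpret Q: finite_measure "positive_part_measure M (\<lambda>A. - \<mu> A)"
    by (rule finite_measure_positive_part[OF ca_uminus[OF \<mu>]])
  show ?thesis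
    using P.emeasure_finite Q.emeasure_finite
    by (intro finite_measureI) (auto simp: emeasure_variation[OF \<mu>])
qed

lemma integrable_variation_bounded:
  fixes \<mu> :: "'w set \<Rightarrow> real" and f :: "'w \<Rightarrow> real"
  assumes "\<mu> \<in> ca M" "f \<in> borel_measurable M" "\<And>x. x \<in> space M \<Longrightarrow> \<bar>f x\<bar> \<le> c"
  shows "integrable (variation_measure M \<mu>) f"
proof -
  interpret finite_measure "variation_measure M \<mu>" by (rule finite_measure_variation[OF assms(1)])
  show ?thesis using assms(2,3) by (intro integrable_const_bound[where B = c]) auto
qed

context
  fixes M :: "'w measure" and \<mu> :: "'w set \<Rightarrow> real"
  assumes \<mu>: "\<mu> \<in> ca M"
begin

private abbreviation "V \<equiv> variation_measure M \<mu>"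
private abbreviation "P \<equiv> positive_part_measure M \<mu>"
private abbreviation "Q \<equiv> positive_part_measure M (\<lambda>A. - \<mu> A)"

lemma signed_set_integral_abs_le:
  assumes f: "integrable V f" and A: "A \<in> sets M"
  shows "\<bar>signed_set_integral M \<mu> A f\<bar> \<le> (\<integral>x. \<bar>f x\<bar> \<partial>V)"
proof -
  have "\<bar>set_lebesgue_integral N A f\<bar> \<le> (\<integral>x. \<bar>f x\<bar> \<partial>N)" if N: "integrable N f" "sets N = sets M" for N
  proof -
    have "\<bar>set_lebesgue_integral N A f\<bar> \<le> (\<integral>x. \<bar>indicator A x *\<^sub>R f x\<bar> \<partial>N)"
      unfolding set_lebesgue_integral_def by (rule integral_abs_bound)
    also have "\<dots> \<le> (\<integral>x. \<bar>f x\<bar> \<partial>N)"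
      using N A by (intro integral_mono integrable_abs integrable_mult_indicator)
        (auto split: split_indicator)
    finally show ?thesis .
  qed
  from this[of P] this[of Q] show ?thesis
    using f integrable_variation_iff[OF \<mu>, of f] integral_variation[OF \<mu>, of "\<lambda>x. \<bar>f x\<bar>"]
    by (auto simp: signed_set_integral_def)
qed

lemma signed_set_integral_add:
  assumes f: "integrable V f" "integrable V g" and A: "A \<in> sets M"
  shows "signed_set_integral M \<mu> A (\<lambda>x. f x + g x) =
    signed_set_integral M \<mu> A f + signed_set_integral M \<mu> A g"
proof -
  have "set_lebesgue_integral R A (\<lambda>x. f x + g x) = set_lebesgue_integral R A f + set_lebesgue_integral R A g"
    if "integrable R f" "integrable R g" "sets R = sets M" for R
    using that A integrable_mult_indicator[of A R]
    by (intro set_integral_add) (auto simp: set_integrable_def simp del: real_scaleR_def)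
  then show ?thesis
    using f by (simp add: signed_set_integral_def integrable_variation_iff[OF \<mu>])
qed

lemma signed_set_integral_indicator:
  assumes "A \<in> sets M" "E \<in> sets M"
  shows "signed_set_integral M \<mu> A (indicator E) = \<mu> (A \<inter> E)"
  using assms Jordan_decomposition[OF \<mu>, of "A \<inter> E"]
  by (simp add: signed_set_integral_def set_lebesgue_integral_def sets.Int_space_eq2
      flip: indicator_inter_arith)

lemma variation_null:
  assumes N: "N \<in> sets M" "\<And>B. B \<in> sets M \<Longrightarrow> B \<subseteq> N \<Longrightarrow> \<mu> B = 0"
  shows "emeasure V N = 0" "emeasure P N = 0" "emeasure Q N = 0"
proof -
  show "emeasure P N = 0" "emeasure Q N = 0"
    using N unfolding emeasure_positive_part[OF \<mu> N(1)] emeasure_positive_part[OF ca_uminus[OF \<mu>] N(1)]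
    by (auto intro!: antisym SUP_least)
  then show "emeasure V N = 0" by (simp add: emeasure_variation[OF \<mu> N(1)])
qed

lemma abs_le_variation:
  assumes A: "A \<in> sets M"
  shows "\<bar>\<mu> A\<bar> \<le> measure V A"
proof -
  have "integrable V (indicator A :: 'w \<Rightarrow> real)"
    using A by (intro integrable_variation_bounded[OF \<mu>, where c = 1]) auto
  from signed_set_integral_abs_le[OF this A] show ?thesis
    using A by (simp add: signed_set_integral_indicator sets.Int_space_eq2)
qed

text \<open>
  The \<open>L\<^sub>1\<close> norm against the variation is controlled by the indefinite integral. It is the difference
  of the integrals over \<open>G\<close> and its complement, where \<open>G\<close> is the set on which the sign of \<open>f\<close> agrees
  with that of the Hahn set.
\<close>

lemma variation_integral_le:
  assumes f: "integrable V f"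
    and K: "\<And>A. A \<in> sets M \<Longrightarrow> \<bar>signed_set_integral M \<mu> A f\<bar> \<le> K"
  shows "(\<integral>x. \<bar>f x\<bar> \<partial>V) \<le> 2 * K"
proof -
  obtain Y where Y: "Y \<in> sets M"
    "\<And>A. A \<in> sets M \<Longrightarrow> emeasure P (A - Y) = 0" "\<And>A. A \<in> sets M \<Longrightarrow> emeasure Q (A \<inter> Y) = 0"
    using Hahn_decomposition[OF \<mu>] by metis
  have fM [measurable]: "f \<in> borel_measurable M"
    using borel_measurable_integrable[OF f] by simp
  note [measurable] = Y(1)
  have i: "integrable P f" "integrable Q f" using f integrable_variation_iff[OF \<mu>] by auto
  define G where "G = {x\<in>space M. x \<in> Y \<longleftrightarrow> 0 \<le> f x}"
  have G [measurable]: "G \<in> sets M" unfolding G_def by measurable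
  have H [measurable]: "space M - G \<in> sets M" by simp
  have diff: "(\<integral>x. indicator G x *\<^sub>R f x - indicator (space M - G) x *\<^sub>R f x \<partial>N) =
      set_lebesgue_integral N G f - set_lebesgue_integral N (space M - G) f"
    if N: "integrable N f" "sets N = sets M" for N
    unfolding set_lebesgue_integral_def using N G H
    by (intro Bochner_Integration.integral_diff integrable_mult_indicator) auto
  have aeP: "AE x in P. x \<in> Y"
    by (rule AE_I'[of "space M - Y"]) (use Y(1) Y(2)[of "space M"] in \<open>auto simp: null_sets_def\<close>)
  have aeQ: "AE x in Q. x \<notin> Y"
    by (rule AE_I'[of "space M \<inter> Y"]) (use Y(1) Y(3)[of "space M"] in \<open>auto simp: null_sets_def\<close>)
  have "(\<integral>x. \<bar>f x\<bar> \<partial>P) = (\<integral>x. indicator G x *\<^sub>R f x - indicator (space M - G) x *\<^sub>R f x \<partial>P)"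
  proof (rule integral_cong_AE)
    show "AE x in P. \<bar>f x\<bar> = indicator G x *\<^sub>R f x - indicator (space M - G) x *\<^sub>R f x"
      using aeP AE_space by eventually_elim (auto simp: G_def split: split_indicator)
  qed auto
  then have intP: "(\<integral>x. \<bar>f x\<bar> \<partial>P) = set_lebesgue_integral P G f - set_lebesgue_integral P (space M - G) f"
    unfolding diff[OF i(1) sets_positive_part] .
  have "(\<integral>x. \<bar>f x\<bar> \<partial>Q) = (\<integral>x. - (indicator G x *\<^sub>R f x - indicator (space M - G) x *\<^sub>R f x) \<partial>Q)"
  proof (rule integral_cong_AE)
    show "AE x in Q. \<bar>f x\<bar> = - (indicator G x *\<^sub>R f x - indicator (space M - G) x *\<^sub>R f x)"
      using aeQ AE_space by eventually_elim (auto simp: G_def split: split_indicator)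
  qed auto
  then have intQ: "(\<integral>x. \<bar>f x\<bar> \<partial>Q) = - (set_lebesgue_integral Q G f - set_lebesgue_integral Q (space M - G) f)"
    unfolding integral_minus diff[OF i(2) sets_positive_part] .
  have "(\<integral>x. \<bar>f x\<bar> \<partial>V) = signed_set_integral M \<mu> G f - signed_set_integral M \<mu> (space M - G) f"
    using f integral_variation[OF \<mu>, of "\<lambda>x. \<bar>f x\<bar>"] intP intQ
    by (simp add: signed_set_integral_def)
  then show ?thesis using K[OF G] K[OF H] by linarith
qed

lemma variation_integral_mono:
  fixes f g :: "'w \<Rightarrow> real"
  assumes f: "integrable V f" and [measurable]: "g \<in> borel_measurable M"
    and "AE x in V. \<bar>g x\<bar> \<le> \<bar>f x\<bar>"
  shows "integrable V g" "(\<integral>x. \<bar>g x\<bar> \<partial>V) \<le> (\<integral>x. \<bar>f x\<bar> \<partial>V)"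
proof -
  show "integrable V g"
    by (rule Bochner_Integration.integrable_bound[OF f]) (use assms(3) in auto)
  then show "(\<integral>x. \<bar>g x\<bar> \<partial>V) \<le> (\<integral>x. \<bar>f x\<bar> \<partial>V)"
    using f assms(3) by (intro integral_mono_AE integrable_abs)
qed

lemma signed_set_integral_cong:
  assumes N: "N \<in> sets M" "\<And>B. B \<in> sets M \<Longrightarrow> B \<subseteq> N \<Longrightarrow> \<mu> B = 0"
    and fg: "f \<in> borel_measurable M" "g \<in> borel_measurable M" "\<And>x. x \<in> space M \<Longrightarrow> x \<notin> N \<Longrightarrow> f x = g x"
    and A: "A \<in> sets M"
  shows "signed_set_integral M \<mu> A f = signed_set_integral M \<mu> A g"
    and "(\<integral>x. \<bar>f x\<bar> \<partial>V) = (\<integral>x. \<bar>g x\<bar> \<partial>V)"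
proof -
  have ae: "AE x in R. f x = g x" if "emeasure R N = 0" "sets R = sets M" for R
    by (rule AE_I'[of N]) (use that N(1) fg(3) sets_eq_imp_space_eq[OF that(2)] in \<open>auto simp: null_sets_def\<close>)
  have "set_lebesgue_integral R A f = set_lebesgue_integral R A g"
    if "emeasure R N = 0" and [measurable_cong]: "sets R = sets M" for R
    unfolding set_lebesgue_integral_def using ae[OF that] fg(1,2) A
    by (intro integral_cong_AE) auto
  then show "signed_set_integral M \<mu> A f = signed_set_integral M \<mu> A g"
    using variation_null[OF N] by (simp add: signed_set_integral_def)
  show "(\<integral>x. \<bar>f x\<bar> \<partial>V) = (\<integral>x. \<bar>g x\<bar> \<partial>V)"
    using ae[of V] variation_null[OF N] fg(1,2) by (intro integral_cong_AE) auto
qed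

lemma signed_set_integral_ca:
  assumes f: "integrable V f"
  shows "(\<lambda>A. signed_set_integral M \<mu> A f) \<in> ca M"
  unfolding ca_def
proof (intro CollectI allI impI)
  fix A :: "nat \<Rightarrow> 'w set" assume A: "range A \<subseteq> sets M" "disjoint_family A"
  have "(\<lambda>i. set_lebesgue_integral R (A i) f) sums set_lebesgue_integral R (\<Union>i. A i) f"
    if R: "integrable R f" "sets R = sets M" for R
  proof -
    have int: "set_integrable R B f" if "B \<in> sets M" for B
      unfolding set_integrable_def using R that by (intro integrable_mult_indicator) auto
    have "(\<Sum>i<n. set_lebesgue_integral R (A i) f) = set_lebesgue_integral R (\<Union>i<n. A i) f" for n
      using A R(2) int
      by (intro set_integral_finite_Union[symmetric]) (auto intro: disjoint_family_on_mono)
    moreover have "(\<lambda>n. set_lebesgue_integral R (\<Union>i<n. A i) f) \<longlonglongrightarrow> set_lebesgue_integral R (\<Union>n. \<Union>i<n. A i) f"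
      using A(1) R(2) by (intro set_integral_cont_up int) (auto simp: incseq_def, force)
    moreover have "(\<Union>n. \<Union>i<n. A i) = (\<Union>i. A i)" by auto
    ultimately show ?thesis by (simp add: sums_def)
  qed
  then show "(\<lambda>n. signed_set_integral M \<mu> (A n) f) sums signed_set_integral M \<mu> (\<Union>n. A n) f"
    using f unfolding signed_set_integral_def
    by (intro sums_diff) (auto simp: integrable_variation_iff[OF \<mu>])
qed

end

lemma AE_summable_norm:
  fixes f :: "nat \<Rightarrow> 'w \<Rightarrow> real"
  assumes f [measurable]: "\<And>i. integrable M (f i)" and s: "summable (\<lambda>i. \<integral>x. \<bar>f i x\<bar> \<partial>M)"
  shows "AE x in M. summable (\<lambda>i. \<bar>f i x\<bar>)"
proof -
  have "(\<integral>\<^sup>+ x. (\<Sum>i. ennreal \<bar>f i x\<bar>) \<partial>M) = (\<Sum>i. \<integral>\<^sup>+ x. ennreal \<bar>f i x\<bar> \<partial>M)"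
    by (intro nn_integral_suminf) auto
  also have "\<dots> = (\<Sum>i. ennreal (\<integral>x. \<bar>f i x\<bar> \<partial>M))"
    using f by (intro suminf_cong nn_integral_eq_integral) auto
  also have "\<dots> \<noteq> \<infinity>"
    using s by (simp add: ennreal_suminf_neq_top)
  finally have "AE x in M. (\<Sum>i. ennreal \<bar>f i x\<bar>) \<noteq> \<infinity>"
    by (intro nn_integral_noteq_infinite) auto
  then show ?thesis
    by eventually_elim (auto intro: summable_suminf_not_top)
qed

lemma signed_set_integral_sums:
  fixes \<mu> :: "'w set \<Rightarrow> real" and f :: "nat \<Rightarrow> 'w \<Rightarrow> real"
  assumes \<mu>: "\<mu> \<in> ca M"
    and f: "\<And>i. integrable (variation_measure M \<mu>) (f i)"
    and s: "summable (\<lambda>i. \<integral>x. \<bar>f i x\<bar> \<partial>variation_measure M \<mu>)"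
    and A: "A \<in> sets M"
  shows "integrable (variation_measure M \<mu>) (\<lambda>x. \<Sum>i. f i x)"
    and "(\<lambda>i. signed_set_integral M \<mu> A (f i)) sums signed_set_integral M \<mu> A (\<lambda>x. \<Sum>i. f i x)"
proof -
  let ?V = "variation_measure M \<mu>"
  let ?P = "positive_part_measure M \<mu>" and ?Q = "positive_part_measure M (\<lambda>B. - \<mu> B)"
  have i: "integrable ?P (f i)" "integrable ?Q (f i)" for i
    using f integrable_variation_iff[OF \<mu>] by auto
  have eq: "(\<integral>x. \<bar>f i x\<bar> \<partial>?V) = (\<integral>x. \<bar>f i x\<bar> \<partial>?P) + (\<integral>x. \<bar>f i x\<bar> \<partial>?Q)" for i
    using f by (intro integral_variation[OF \<mu>]) auto
  show "integrable ?V (\<lambda>x. \<Sum>i. f i x)"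
    using AE_summable_norm[OF f s] f s by (intro integrable_suminf) auto
  have *: "(\<lambda>i. set_lebesgue_integral R A (f i)) sums set_lebesgue_integral R A (\<lambda>x. \<Sum>i. f i x)"
    if R: "\<And>i. integrable R (f i)" "sets R = sets M"
      and le: "\<And>i. (\<integral>x. \<bar>f i x\<bar> \<partial>R) \<le> (\<integral>x. \<bar>f i x\<bar> \<partial>?V)" for R
  proof -
    have sR: "summable (\<lambda>i. \<integral>x. \<bar>f i x\<bar> \<partial>R)"
      by (rule summable_comparison_test_ev[OF _ s]) (use le in auto)
    note ae = AE_summable_norm[OF R(1) sR]
    have "(\<lambda>i. \<integral>x. indicator A x *\<^sub>R f i x \<partial>R) sums (\<integral>x. (\<Sum>i. indicator A x *\<^sub>R f i x) \<partial>R)"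
    proof (rule sums_integral)
      show "integrable R (\<lambda>x. indicator A x *\<^sub>R f i x)" for i
        using R A by (intro integrable_mult_indicator) auto
      show "AE x in R. summable (\<lambda>i. norm (indicator A x *\<^sub>R f i x))"
        using ae by eventually_elim (auto split: split_indicator)
      have "(\<integral>x. \<bar>indicator A x *\<^sub>R f i x\<bar> \<partial>R) \<le> (\<integral>x. \<bar>f i x\<bar> \<partial>R)" for i
        using R A by (intro integral_mono integrable_abs integrable_mult_indicator)
          (auto split: split_indicator)
      then show "summable (\<lambda>i. \<integral>x. norm (indicator A x *\<^sub>R f i x) \<partial>R)"
        by (intro summable_comparison_test_ev[OF _ sR]) auto
    qed
    also have "(\<integral>x. (\<Sum>i. indicator A x *\<^sub>R f i x) \<partial>R) = (\<integral>x. indicator A x *\<^sub>R (\<Sum>i. f i x) \<partial>R)"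
      by (intro Bochner_Integration.integral_cong) (auto split: split_indicator)
    finally show ?thesis by (simp add: set_lebesgue_integral_def)
  qed
  show "(\<lambda>i. signed_set_integral M \<mu> A (f i)) sums signed_set_integral M \<mu> A (\<lambda>x. \<Sum>i. f i x)"
    unfolding signed_set_integral_def using i eq by (intro sums_diff *) auto
qed

section \<open>Integration against a vector measure\<close>

lemma has_vm_integral_unique:
  assumes "has_vm_integral M \<eta> A f z" "has_vm_integral M \<eta> A f w"
  shows "z = w"
  by (rule functionals_separate) (metis assms has_vm_integral_def)

lemma vm_integral_eq:
  "has_vm_integral M \<eta> A f z \<Longrightarrow> vm_integral M \<eta> A f = z"
  unfolding vm_integral_def using has_vm_integral_unique by blast

lemma vm_integrable_imp_has_vm_integral:
  "vm_integrable M \<eta> f \<Longrightarrow> A \<in> sets M \<Longrightarrow> has_vm_integral M \<eta> A f (vm_integral M \<eta> A f)"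
  using vm_integral_eq unfolding vm_integrable_def by metis

lemma has_vm_integral_restrict:
  "has_vm_integral M \<eta> A (\<lambda>x. indicator B x * f x) z \<longleftrightarrow> has_vm_integral M \<eta> (A \<inter> B) f z"
  by (simp add: has_vm_integral_def signed_set_integral_restrict)

lemma has_vm_integral_cmult:
  assumes "has_vm_integral M \<eta> A f z"
  shows "has_vm_integral M \<eta> A (\<lambda>x. c * f x) (c *\<^sub>R z)"
  using assms
  by (simp add: has_vm_integral_def signed_set_integral_cmult blinfun.scaleR_right)

lemma has_vm_integral_add:
  assumes \<eta>: "\<eta> \<in> ca M" and A: "A \<in> sets M"
    and f: "has_vm_integral M \<eta> A f z"
      "\<And>z' :: 'a::real_normed_vector \<Rightarrow>\<^sub>L real. integrable (variation_measure M (blinfun_apply z' \<circ> \<eta>)) f"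
    and g: "has_vm_integral M \<eta> A g w"
      "\<And>z' :: 'a \<Rightarrow>\<^sub>L real. integrable (variation_measure M (blinfun_apply z' \<circ> \<eta>)) g"
  shows "has_vm_integral M \<eta> A (\<lambda>x. f x + g x) (z + w)"
  using f(1) g(1)
  by (simp add: has_vm_integral_def signed_set_integral_add[OF ca_functional[OF \<eta>] f(2) g(2) A] blinfun.add_right)

lemma has_vm_integral_indicator:
  assumes "\<eta> \<in> ca M" "A \<in> sets M" "E \<in> sets M"
  shows "has_vm_integral M \<eta> A (indicator E) (\<eta> (A \<inter> E))"
  using assms by (simp add: has_vm_integral_def signed_set_integral_indicator[OF ca_functional])

lemma has_vm_integral_cong:
  assumes \<eta>: "\<eta> \<in> ca M" and "f \<in> borel_measurable M" "g \<in> borel_measurable M"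
    and N: "{x \<in> space M. f x \<noteq> g x} \<in> vm_null_sets M \<eta>" and A: "A \<in> sets M"
  shows "has_vm_integral M \<eta> A f z \<longleftrightarrow> has_vm_integral M \<eta> A g z"
proof -
  have "signed_set_integral M (blinfun_apply z' \<circ> \<eta>) A f = signed_set_integral M (blinfun_apply z' \<circ> \<eta>) A g" for z'
    by (rule signed_set_integral_cong[OF ca_functional[OF \<eta>], where N = "{x \<in> space M. f x \<noteq> g x}"])
      (use assms in \<open>auto simp: vm_null_sets_def\<close>)
  then show ?thesis by (simp add: has_vm_integral_def)
qed

lemma empty_vm_null: "\<eta> \<in> ca M \<Longrightarrow> {} \<in> vm_null_sets M \<eta>"
  by (simp add: vm_null_sets_def ca_empty)

lemma has_vm_integral_cong_space:
  assumes \<eta>: "\<eta> \<in> ca M" and fg: "f \<in> borel_measurable M" "g \<in> borel_measurable M"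
    and eq: "\<And>x. x \<in> space M \<Longrightarrow> f x = g x" and A: "A \<in> sets M"
  shows "has_vm_integral M \<eta> A f z \<longleftrightarrow> has_vm_integral M \<eta> A g z"
proof (rule has_vm_integral_cong[OF \<eta> fg _ A])
  have "{x \<in> space M. f x \<noteq> g x} = {}" using eq by blast
  then show "{x \<in> space M. f x \<noteq> g x} \<in> vm_null_sets M \<eta>" using empty_vm_null[OF \<eta>] by (simp only:)
qed

section \<open>Bounded functions are integrable\<close>

lemma binary_digits_sums:
  fixes y :: real
  assumes "0 \<le> y" "y < 1"
  shows "(\<lambda>k. (if odd \<lfloor>2 ^ Suc k * y\<rfloor> then 1 else 0) / 2 ^ Suc k) sums y"
proof -
  have step: "real_of_int \<lfloor>2 * x\<rfloor> = 2 * real_of_int \<lfloor>x\<rfloor> + (if odd \<lfloor>2 * x\<rfloor> then 1 else 0)" for x :: real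
  proof -
    have "\<lfloor>2 * x\<rfloor> = 2 * \<lfloor>x\<rfloor> \<or> \<lfloor>2 * x\<rfloor> = 2 * \<lfloor>x\<rfloor> + 1"
      by linarith
    then show ?thesis by auto
  qed
  have "(\<Sum>k<n. (if odd \<lfloor>2 ^ Suc k * y\<rfloor> then 1 else 0) / 2 ^ Suc k) = \<lfloor>2 ^ n * y\<rfloor> / 2 ^ n" for n
  proof (induction n)
    case 0
    show ?case using assms by (simp add: floor_eq_iff)
  next
    case (Suc n)
    then show ?case using step[of "2 ^ n * y"] by (simp add: field_simps)
  qed
  moreover have "(\<lambda>n. real_of_int \<lfloor>2 ^ n * y\<rfloor> / 2 ^ n) \<longlonglongrightarrow> y"
  proof (rule real_tendsto_sandwich[of "\<lambda>n. y - (1 / 2) ^ n" _ _ "\<lambda>n. y"])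
    have "y - (1 / 2) ^ n \<le> real_of_int \<lfloor>2 ^ n * y\<rfloor> / 2 ^ n" for n
    proof -
      have "2 ^ n * y - 1 \<le> real_of_int \<lfloor>2 ^ n * y\<rfloor>" by linarith
      from divide_right_mono[OF this, of "2 ^ n"] show ?thesis
        by (simp add: diff_divide_distrib power_one_over)
    qed
    then show "\<forall>\<^sub>F n in sequentially. y - (1 / 2) ^ n \<le> real_of_int \<lfloor>2 ^ n * y\<rfloor> / 2 ^ n"
      by simp
    have "(\<lambda>n. y - (1 / 2) ^ n) \<longlonglongrightarrow> y - 0"
      by (intro tendsto_intros LIMSEQ_power_zero) auto
    then show "(\<lambda>n. y - (1 / 2) ^ n) \<longlonglongrightarrow> y" by simp
    have "real_of_int \<lfloor>2 ^ n * y\<rfloor> / 2 ^ n \<le> y" for n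
      by (simp add: divide_le_eq mult.commute)
    then show "\<forall>\<^sub>F n in sequentially. real_of_int \<lfloor>2 ^ n * y\<rfloor> / 2 ^ n \<le> y" by simp
  qed simp
  ultimately show ?thesis by (simp add: sums_def)
qed

text \<open>
  Expanding \<open>g = (\<Sum>k. 2 powi (- k - 1) * indicator (E k))\<close> in binary digits turns the integral into
  the absolutely convergent series of the vectors \<open>2 powi (- k - 1) *\<^sub>R \<eta> (A \<inter> E k)\<close>.
\<close>

lemma unit_valued_has_vm_integral:
  fixes \<eta> :: "'w set \<Rightarrow> 'a::banach"
  assumes \<eta>: "\<eta> \<in> ca M" and [measurable]: "g \<in> borel_measurable M"
    and g: "\<And>x. x \<in> space M \<Longrightarrow> 0 \<le> g x \<and> g x < 1"
    and A: "A \<in> sets M"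
  shows "\<exists>z. has_vm_integral M \<eta> A g z"
proof -
  obtain K where K: "\<And>A. A \<in> sets M \<Longrightarrow> norm (\<eta> A) \<le> K"
    using ca_bounded[OF \<eta>] by blast
  define E where "E k = {x\<in>space M. odd \<lfloor>2 ^ Suc k * g x\<rfloor>}" for k
  have E [measurable]: "E k \<in> sets M" for k
    unfolding E_def by measurable
  have geo: "summable (\<lambda>k. c / 2 ^ Suc k)" for c :: real
    using summable_mult[OF summable_geometric[of "1 / 2 :: real"], of "c / 2"]
    by (simp add: power_one_over)
  have "summable (\<lambda>k. (1 / 2 ^ Suc k) *\<^sub>R \<eta> (A \<inter> E k))"
    by (rule summable_comparison_test_ev[OF _ geo[of K]])
      (use K A in \<open>auto intro!: always_eventually divide_right_mono\<close>)
  then obtain z where z: "(\<lambda>k. (1 / 2 ^ Suc k) *\<^sub>R \<eta> (A \<inter> E k)) sums z"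
    unfolding summable_def by blast
  have "has_vm_integral M \<eta> A g z"
    unfolding has_vm_integral_def
  proof
    fix z' :: "'a \<Rightarrow>\<^sub>L real"
    define \<mu> where "\<mu> = blinfun_apply z' \<circ> \<eta>"
    have \<mu>: "\<mu> \<in> ca M" unfolding \<mu>_def by (rule ca_functional[OF \<eta>])
    interpret V: finite_measure "variation_measure M \<mu>" by (rule finite_measure_variation[OF \<mu>])
    define f where "f k x = (1 / 2 ^ Suc k) * (indicator (E k) x :: real)" for k x
    have i: "integrable (variation_measure M \<mu>) (f k)" for k
      unfolding f_def by (rule integrable_variation_bounded[OF \<mu>, where c = 1])
        (auto split: split_indicator simp: one_le_power divide_le_eq_1 simp del: power_Suc)
    have "(\<lambda>k. signed_set_integral M \<mu> A (f k)) sums signed_set_integral M \<mu> A (\<lambda>x. \<Sum>k. f k x)"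
    proof (rule signed_set_integral_sums[OF \<mu> i _ A])
      have "(\<integral>x. \<bar>f k x\<bar> \<partial>variation_measure M \<mu>) \<le> measure (variation_measure M \<mu>) (space M) / 2 ^ Suc k" for k
        using V.bounded_measure[of "E k"] E[THEN sets.sets_into_space]
        by (simp add: f_def abs_mult divide_right_mono Int_absorb2)
      then show "summable (\<lambda>k. \<integral>x. \<bar>f k x\<bar> \<partial>variation_measure M \<mu>)"
        by (intro summable_comparison_test_ev[OF _ geo[of "measure (variation_measure M \<mu>) (space M)"]]) auto
    qed
    moreover have "signed_set_integral M \<mu> A (f k) = blinfun_apply z' ((1 / 2 ^ Suc k) *\<^sub>R \<eta> (A \<inter> E k))" for k
      unfolding f_def signed_set_integral_cmult signed_set_integral_indicator[OF \<mu> A E]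
      by (simp add: \<mu>_def blinfun.scaleR_right)
    moreover have "signed_set_integral M \<mu> A (\<lambda>x. \<Sum>k. f k x) = signed_set_integral M \<mu> A g"
    proof (rule signed_set_integral_cong[OF \<mu>, of "{}"])
      show "(\<Sum>k. f k x) = g x" if "x \<in> space M" for x
      proof -
        have "f k x = (if odd \<lfloor>2 ^ Suc k * g x\<rfloor> then 1 else 0) / 2 ^ Suc k" for k
          using that by (simp add: f_def E_def)
        then show ?thesis
          using binary_digits_sums[of "g x"] g[OF that] by (simp add: sums_iff)
      qed
      show "(\<lambda>x. \<Sum>k. f k x) \<in> borel_measurable M"
        unfolding f_def by measurable
    qed (use A ca_empty[OF \<mu>] in auto)
    ultimately have "(\<lambda>k. blinfun_apply z' ((1 / 2 ^ Suc k) *\<^sub>R \<eta> (A \<inter> E k))) sums signed_set_integral M \<mu> A g"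
      by simp
    moreover have "(\<lambda>k. blinfun_apply z' ((1 / 2 ^ Suc k) *\<^sub>R \<eta> (A \<inter> E k))) sums blinfun_apply z' z"
      by (rule bounded_linear.sums[OF blinfun.bounded_linear_right z])
    ultimately show "blinfun_apply z' z = signed_set_integral M (blinfun_apply z' \<circ> \<eta>) A g"
      unfolding \<mu>_def using sums_unique2 by blast
  qed
  then show ?thesis by blast
qed

proposition bounded_has_vm_integral:
  fixes \<eta> :: "'w set \<Rightarrow> 'a::banach"
  assumes \<eta>: "\<eta> \<in> ca M" and f [measurable]: "f \<in> borel_measurable M"
    and c: "\<And>x. x \<in> space M \<Longrightarrow> \<bar>f x\<bar> \<le> c"
    and A: "A \<in> sets M"
  shows "\<exists>z. has_vm_integral M \<eta> A f z"
proof -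
  \<comment> \<open>The affine image \<open>(f + d) / (2 * d)\<close> has values in \<open>[0, 1)\<close>; the summand \<open>1\<close> makes \<open>d\<close> positive and the bound strict.\<close>
  define d where "d = \<bar>c\<bar> + 1"
  have d: "0 < d" "\<And>x. x \<in> space M \<Longrightarrow> \<bar>f x\<bar> < d"
    using c by (fastforce simp: d_def)+
  define g where "g x = (f x + d) / (2 * d)" for x
  have [measurable]: "g \<in> borel_measurable M" unfolding g_def by measurable
  have g: "0 \<le> g x \<and> g x < 1" if "x \<in> space M" for x
    using d(1) d(2)[OF that] by (auto simp: g_def field_simps abs_less_iff)
  obtain z where z: "has_vm_integral M \<eta> A g z"
    using unit_valued_has_vm_integral[OF \<eta> \<open>g \<in> borel_measurable M\<close> g A] by blast
  have "has_vm_integral M \<eta> A (\<lambda>x. 2 * d * g x + (- d) * indicator (space M) x) ((2 * d) *\<^sub>R z + (- d) *\<^sub>R \<eta> (A \<inter> space M))"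
  proof (intro has_vm_integral_add[OF \<eta> A] has_vm_integral_cmult z
      has_vm_integral_indicator[OF \<eta> A sets.top])
    fix z' :: "'a \<Rightarrow>\<^sub>L real"
    note \<mu> = ca_functional[OF \<eta>, of z']
    show "integrable (variation_measure M (blinfun_apply z' \<circ> \<eta>)) (\<lambda>x. 2 * d * g x)"
      by (rule integrable_variation_bounded[OF \<mu>, where c = "2 * d"]) (use g d in \<open>auto simp: abs_mult intro: less_imp_le\<close>)
    show "integrable (variation_measure M (blinfun_apply z' \<circ> \<eta>)) (\<lambda>x. - d * indicator (space M) x)"
      by (rule integrable_variation_bounded[OF \<mu>, where c = d]) (use d in \<open>auto simp: abs_mult\<close>)
  qed
  then have "has_vm_integral M \<eta> A f ((2 * d) *\<^sub>R z + (- d) *\<^sub>R \<eta> (A \<inter> space M))"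
    using d(1) A by (subst (asm) has_vm_integral_cong_space[OF \<eta>, where g = f]) (auto simp: g_def)
  then show ?thesis by blast
qed

section \<open>Integrability from a countably additive extension\<close>

text \<open>
  If the integrals of \<open>f\<close> over the sets on which \<open>f\<close> is bounded extend to a countably additive
  \<open>\<theta>\<close>, then \<open>f\<close> is integrable and \<open>\<theta>\<close> is its indefinite integral. Boundedness of \<open>\<theta>\<close> bounds the
  integrals of the truncations of \<open>\<bar>f\<bar>\<close>, and monotone convergence applies; the values of the
  integral are then recovered by countable additivity.
\<close>

lemma integrable_if_truncations_extend:
  fixes \<mu> \<theta> :: "'w set \<Rightarrow> real"
  assumes \<mu>: "\<mu> \<in> ca M" and \<theta>: "\<theta> \<in> ca M" and f [measurable]: "f \<in> borel_measurable M"
    and agree: "\<And>n A. A \<in> sets M \<Longrightarrow> (\<And>x. x \<in> A \<Longrightarrow> \<bar>f x\<bar> \<le> real n) \<Longrightarrow>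
      \<theta> A = signed_set_integral M \<mu> A f"
  shows "integrable (variation_measure M \<mu>) f"
    and "A \<in> sets M \<Longrightarrow> \<theta> A = signed_set_integral M \<mu> A f"
proof -
  let ?V = "variation_measure M \<mu>"
  obtain K where K: "\<And>A. A \<in> sets M \<Longrightarrow> norm (\<theta> A) \<le> K" using ca_bounded[OF \<theta>] by blast
  define E where "E n = {x\<in>space M. \<bar>f x\<bar> \<le> real n}" for n
  have E [measurable]: "E n \<in> sets M" for n unfolding E_def by measurable
  have Ef: "\<bar>indicator (E n) x * f x\<bar> = indicator (E n) x * \<bar>f x\<bar>" for n x
    by (simp add: abs_mult)
  have i: "integrable ?V (\<lambda>x. indicator (E n) x * f x)" for n
    by (rule integrable_variation_bounded[OF \<mu>, where c = n]) (auto simp: E_def split: split_indicator)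
  have le: "(\<integral>x. indicator (E n) x * \<bar>f x\<bar> \<partial>?V) \<le> 2 * K" for n
    unfolding Ef[symmetric]
  proof (rule variation_integral_le[OF \<mu> i])
    fix A assume A: "A \<in> sets M"
    have "\<theta> (A \<inter> E n) = signed_set_integral M \<mu> (A \<inter> E n) f"
      using A by (intro agree[of _ n]) (auto simp: E_def)
    then show "\<bar>signed_set_integral M \<mu> A (\<lambda>x. indicator (E n) x * f x)\<bar> \<le> K"
      using K[of "A \<inter> E n"] A by (simp add: signed_set_integral_restrict)
  qed
  have j: "integrable ?V (\<lambda>x. indicator (E n) x * \<bar>f x\<bar>)" for n
    using integrable_abs[OF i[of n]] by (simp only: Ef)
  have mono: "indicator (E m) x * \<bar>f x\<bar> \<le> indicator (E n) x * \<bar>f x\<bar>" if "m \<le> n" for m n x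
    using that by (auto simp: E_def split: split_indicator)
  have "incseq (\<lambda>n. \<integral>x. indicator (E n) x * \<bar>f x\<bar> \<partial>?V)"
    using mono j by (intro incseq_SucI integral_mono) auto
  then obtain L where L: "(\<lambda>n. \<integral>x. indicator (E n) x * \<bar>f x\<bar> \<partial>?V) \<longlonglongrightarrow> L"
    using incseq_convergent le by blast
  have "integrable ?V (\<lambda>x. \<bar>f x\<bar>)"
  proof (rule integrable_monotone_convergence[OF j _ _ L])
    show "AE x in ?V. mono (\<lambda>n. indicator (E n) x * \<bar>f x\<bar>)"
      using mono by (auto simp: mono_def)
    show "AE x in ?V. (\<lambda>n. indicator (E n) x * \<bar>f x\<bar>) \<longlonglongrightarrow> \<bar>f x\<bar>"
    proof (rule AE_I2)
      fix x assume x: "x \<in> space ?V"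
      show "(\<lambda>n. indicator (E n) x * \<bar>f x\<bar>) \<longlonglongrightarrow> \<bar>f x\<bar>"
      proof (rule tendsto_eventually, rule eventually_sequentiallyI)
        fix n assume "nat \<lceil>\<bar>f x\<bar>\<rceil> \<le> n"
        then have "\<bar>f x\<bar> \<le> real n" by linarith
        then show "indicator (E n) x * \<bar>f x\<bar> = \<bar>f x\<bar>" using x by (simp add: E_def)
      qed
    qed
  qed simp
  then show f_int: "integrable ?V f"
    by (subst (asm) integrable_abs_iff) auto
  assume A: "A \<in> sets M"
  let ?D = "disjointed (\<lambda>n. A \<inter> E n)"
  have D: "range ?D \<subseteq> sets M" "disjoint_family ?D"
    using A by (auto intro!: sets.range_disjointed_sets disjoint_family_disjointed)
  have UN: "(\<Union>n. ?D n) = A"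
  proof -
    have "\<exists>n. x \<in> E n" if "x \<in> A" for x
      using sets.sets_into_space[OF A] that real_arch_simple[of "\<bar>f x\<bar>"] by (auto simp: E_def)
    then show ?thesis unfolding UN_disjointed_eq by blast
  qed
  have "\<theta> (?D n) = signed_set_integral M \<mu> (?D n) f" for n
    using D(1) disjointed_subset[of "\<lambda>n. A \<inter> E n" n] by (intro agree[of _ n]) (auto simp: E_def)
  then show "\<theta> A = signed_set_integral M \<mu> A f"
    using caD[OF \<theta> D] caD[OF signed_set_integral_ca[OF \<mu> f_int] D] UN sums_unique2 by auto
qed

section \<open>The norm of integrable functions\<close>

text \<open>
  The norm of \<open>L\<^sub>1(\<eta>)\<close> on functions instead of classes. It is a supremum of real numbers, hence
  meaningful only when the integrals against the variations are bounded for functionals in the unit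
  ball; this is the role of the constant \<open>K\<close> in the lemmas below.
\<close>

definition vm_norm :: "'w measure \<Rightarrow> ('w set \<Rightarrow> 'a::real_normed_vector) \<Rightarrow> ('w \<Rightarrow> real) \<Rightarrow> real" where
  "vm_norm M \<eta> f = (SUP z'\<in>cball (0 :: 'a \<Rightarrow>\<^sub>L real) 1.
     integral\<^sup>L (variation_measure M (blinfun_apply z' \<circ> \<eta>)) (\<lambda>x. \<bar>f x\<bar>))"

text \<open>
  All members of a class have the same norm and integral, so the \<^const>\<open>the_elem\<close> in the definitions of
  \<^const>\<open>L1_norm\<close> and \<^const>\<open>integration_op\<close> is applied to a singleton.
\<close>

lemma L1_class_values:
  fixes \<eta> :: "'w set \<Rightarrow> 'a::real_normed_vector"
  assumes \<eta>: "\<eta> \<in> ca M" and f: "vm_integrable M \<eta> f"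
  defines "F \<equiv> vm_ae_eq M \<eta> `` {f}"
  shows "F \<in> L1 M \<eta>" "L1_norm M \<eta> F = vm_norm M \<eta> f"
    "integration_op M \<eta> F = vm_integral M \<eta> (space M) f"
proof -
  show "F \<in> L1 M \<eta>" using f by (auto simp: F_def L1_def quotient_def)
  have fF: "f \<in> F" using f empty_vm_null[OF \<eta>] by (simp add: F_def vm_ae_eq_def)
  have gF: "vm_norm M \<eta> g = vm_norm M \<eta> f" "vm_integral M \<eta> (space M) g = vm_integral M \<eta> (space M) f"
    if g: "g \<in> F" for g
  proof -
    have N: "{x \<in> space M. f x \<noteq> g x} \<in> vm_null_sets M \<eta>"
      and meas: "f \<in> borel_measurable M" "g \<in> borel_measurable M"
      using g by (auto simp: F_def vm_ae_eq_def vm_integrable_def)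
    show "vm_integral M \<eta> (space M) g = vm_integral M \<eta> (space M) f"
      unfolding vm_integral_def
      by (rule arg_cong[where f = The]) (simp add: fun_eq_iff has_vm_integral_cong[OF \<eta> meas N])
    have "(\<integral>x. \<bar>f x\<bar> \<partial>variation_measure M (blinfun_apply z' \<circ> \<eta>)) =
        (\<integral>x. \<bar>g x\<bar> \<partial>variation_measure M (blinfun_apply z' \<circ> \<eta>))" for z'
      by (rule signed_set_integral_cong(2)[OF ca_functional[OF \<eta>], where N = "{x \<in> space M. f x \<noteq> g x}"])
        (use N meas in \<open>auto simp: vm_null_sets_def\<close>)
    then show "vm_norm M \<eta> g = vm_norm M \<eta> f" by (simp add: vm_norm_def)
  qed
  have norm_img: "vm_norm M \<eta> ` F = {vm_norm M \<eta> f}"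
    by (rule trans[OF image_cong[OF refl gF(1)] image_constant[OF fF]])
  have int_img: "vm_integral M \<eta> (space M) ` F = {vm_integral M \<eta> (space M) f}"
    by (rule trans[OF image_cong[OF refl gF(2)] image_constant[OF fF]])
  have "L1_norm M \<eta> F = the_elem (vm_norm M \<eta> ` F)"
    unfolding L1_norm_def vm_norm_def[abs_def] ..
  then show "L1_norm M \<eta> F = vm_norm M \<eta> f" by (simp only: norm_img the_elem_eq)
  show "integration_op M \<eta> F = vm_integral M \<eta> (space M) f"
    by (simp only: integration_op_def int_img the_elem_eq)
qed

lemma L1_E:
  assumes "F \<in> L1 M \<eta>"
  obtains f where "vm_integrable M \<eta> f" "F = vm_ae_eq M \<eta> `` {f}"
  using assms by (auto simp: L1_def quotient_def)

lemma vm_integrable_restrict: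
  assumes \<eta>: "\<eta> \<in> ca M" and f: "vm_integrable M \<eta> f" and B [measurable]: "B \<in> sets M"
  shows "vm_integrable M \<eta> (\<lambda>x. indicator B x * f x)"
  unfolding vm_integrable_def
proof (intro conjI allI ballI)
  show "(\<lambda>x. indicator B x * f x) \<in> borel_measurable M"
    using f by (auto simp: vm_integrable_def)
  show "integrable (variation_measure M (blinfun_apply z' \<circ> \<eta>)) (\<lambda>x. indicator B x * f x)" for z'
    using f B integrable_mult_indicator[of B "variation_measure M (blinfun_apply z' \<circ> \<eta>)" f]
    by (simp add: vm_integrable_def)
  show "\<exists>z. has_vm_integral M \<eta> A (\<lambda>x. indicator B x * f x) z" if "A \<in> sets M" for A
    unfolding has_vm_integral_restrict
    using vm_integrable_imp_has_vm_integral[OF f, of "A \<inter> B"] that B by (intro exI) auto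
qed

lemma variation_integral_le_if_vm_integrals_le:
  fixes z' :: "'a::real_normed_vector \<Rightarrow>\<^sub>L real"
  assumes \<eta>: "\<eta> \<in> ca M" and f: "vm_integrable M \<eta> f"
    and K: "\<And>A. A \<in> sets M \<Longrightarrow> norm (vm_integral M \<eta> A f) \<le> K"
  shows "(\<integral>x. \<bar>f x\<bar> \<partial>variation_measure M (blinfun_apply z' \<circ> \<eta>)) \<le> 2 * (norm z' * K)"
proof (rule variation_integral_le[OF ca_functional[OF \<eta>]])
  show "integrable (variation_measure M (blinfun_apply z' \<circ> \<eta>)) f"
    using f by (simp add: vm_integrable_def)
  fix A assume A: "A \<in> sets M"
  have "signed_set_integral M (blinfun_apply z' \<circ> \<eta>) A f = blinfun_apply z' (vm_integral M \<eta> A f)"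
    using vm_integrable_imp_has_vm_integral[OF f A] by (simp add: has_vm_integral_def)
  also have "\<bar>\<dots>\<bar> \<le> norm z' * norm (vm_integral M \<eta> A f)"
    using norm_blinfun[of z'] by simp
  also have "\<dots> \<le> norm z' * K" using K[OF A] by (rule mult_left_mono) simp
  finally show "\<bar>signed_set_integral M (blinfun_apply z' \<circ> \<eta>) A f\<bar> \<le> norm z' * K" .
qed

text \<open>
  The norm is equivalent to the supremum over measurable sets of the norms of the integrals.
\<close>

lemma vm_norm_bounds:
  fixes \<eta> :: "'w set \<Rightarrow> 'a::real_normed_vector"
  assumes \<eta>: "\<eta> \<in> ca M" and f: "vm_integrable M \<eta> f"
    and K: "\<And>A. A \<in> sets M \<Longrightarrow> norm (vm_integral M \<eta> A f) \<le> K"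
  shows "A \<in> sets M \<Longrightarrow> norm (vm_integral M \<eta> A f) \<le> vm_norm M \<eta> f"
    and "vm_norm M \<eta> f \<le> 2 * K"
proof -
  have K0: "0 \<le> K" using K[of "{}"] norm_ge_zero order_trans by blast
  have le: "(\<integral>x. \<bar>f x\<bar> \<partial>variation_measure M (blinfun_apply z' \<circ> \<eta>)) \<le> 2 * K" if "norm z' \<le> 1" for z' :: "'a \<Rightarrow>\<^sub>L real"
    using variation_integral_le_if_vm_integrals_le[OF \<eta> f K, of z'] mult_right_mono[OF that K0] by simp
  then show "vm_norm M \<eta> f \<le> 2 * K"
    unfolding vm_norm_def by (intro cSUP_least) auto
  assume A: "A \<in> sets M"
  show "norm (vm_integral M \<eta> A f) \<le> vm_norm M \<eta> f"
  proof (rule norm_le_if_functionals_le)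
    fix z' :: "'a \<Rightarrow>\<^sub>L real" assume z': "norm z' \<le> 1"
    have "\<bar>blinfun_apply z' (vm_integral M \<eta> A f)\<bar> = \<bar>signed_set_integral M (blinfun_apply z' \<circ> \<eta>) A f\<bar>"
      using vm_integrable_imp_has_vm_integral[OF f A] by (simp add: has_vm_integral_def)
    also have "\<dots> \<le> (\<integral>x. \<bar>f x\<bar> \<partial>variation_measure M (blinfun_apply z' \<circ> \<eta>))"
      using f A by (intro signed_set_integral_abs_le[OF ca_functional[OF \<eta>]]) (auto simp: vm_integrable_def)
    also have "\<dots> \<le> vm_norm M \<eta> f"
      unfolding vm_norm_def using z' le by (intro cSUP_upper bdd_aboveI2) auto
    finally show "\<bar>blinfun_apply z' (vm_integral M \<eta> A f)\<bar> \<le> vm_norm M \<eta> f" .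
  qed
qed

section \<open>Absolute values and series of integrable functions\<close>

lemma has_vm_integral_abs:
  assumes \<eta>: "\<eta> \<in> ca M" and f: "vm_integrable M \<eta> f" and A: "A \<in> sets M"
  defines "B \<equiv> {x \<in> space M. 0 \<le> f x}"
  shows "has_vm_integral M \<eta> A (\<lambda>x. \<bar>f x\<bar>) (vm_integral M \<eta> (A \<inter> B) f - vm_integral M \<eta> (A - B) f)"
proof -
  have [measurable]: "f \<in> borel_measurable M" using f by (simp add: vm_integrable_def)
  have B [measurable]: "B \<in> sets M" unfolding B_def by measurable
  have AB: "A \<inter> (space M - B) = A - B" using sets.sets_into_space[OF A] by blast
  have i: "integrable (variation_measure M (blinfun_apply z' \<circ> \<eta>)) (\<lambda>x. indicator C x * f x)"
    if "C \<in> sets M" for C z'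
    using vm_integrable_restrict[OF \<eta> f that] by (simp add: vm_integrable_def)
  have h: "has_vm_integral M \<eta> A (\<lambda>x. indicator C x * f x) (vm_integral M \<eta> (A \<inter> C) f)" if "C \<in> sets M" for C
    unfolding has_vm_integral_restrict using A that
    by (intro vm_integrable_imp_has_vm_integral[OF f]) auto
  have "has_vm_integral M \<eta> A (\<lambda>x. indicator B x * f x + (- 1) * (indicator (space M - B) x * f x))
      (vm_integral M \<eta> (A \<inter> B) f + (- 1) *\<^sub>R vm_integral M \<eta> (A \<inter> (space M - B)) f)"
    by (intro has_vm_integral_add[OF \<eta> A] has_vm_integral_cmult h i integrable_mult_right) auto
  then have "has_vm_integral M \<eta> A (\<lambda>x. \<bar>f x\<bar>)
      (vm_integral M \<eta> (A \<inter> B) f + (- 1) *\<^sub>R vm_integral M \<eta> (A \<inter> (space M - B)) f)"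
    by (subst (asm) has_vm_integral_cong_space[OF \<eta> _ _ _ A, where g = "\<lambda>x. \<bar>f x\<bar>"])
      (auto simp: B_def split: split_indicator)
  then show ?thesis by (simp add: AB)
qed

lemma scaled_abs_vm_integrable:
  assumes \<eta>: "\<eta> \<in> ca M" and f: "vm_integrable M \<eta> f"
    and K: "\<And>A. A \<in> sets M \<Longrightarrow> norm (vm_integral M \<eta> A f) \<le> K" and c: "0 \<le> c"
  shows "vm_integrable M \<eta> (\<lambda>x. c * \<bar>f x\<bar>)"
    and "A \<in> sets M \<Longrightarrow> norm (vm_integral M \<eta> A (\<lambda>x. c * \<bar>f x\<bar>)) \<le> 2 * c * K"
proof -
  have [measurable]: "f \<in> borel_measurable M" using f by (simp add: vm_integrable_def)
  define B where "B = {x \<in> space M. 0 \<le> f x}"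
  have B [measurable]: "B \<in> sets M" unfolding B_def by measurable
  have h: "has_vm_integral M \<eta> A (\<lambda>x. c * \<bar>f x\<bar>) (c *\<^sub>R (vm_integral M \<eta> (A \<inter> B) f - vm_integral M \<eta> (A - B) f))"
    if "A \<in> sets M" for A
    unfolding B_def by (rule has_vm_integral_cmult[OF has_vm_integral_abs[OF \<eta> f that]])
  then show "vm_integrable M \<eta> (\<lambda>x. c * \<bar>f x\<bar>)"
    using f unfolding vm_integrable_def by (auto intro!: integrable_mult_right integrable_abs)
  assume A: "A \<in> sets M"
  have "norm (vm_integral M \<eta> (A \<inter> B) f - vm_integral M \<eta> (A - B) f) \<le> K + K"
    using A B by (intro norm_triangle_le_diff add_mono K) auto
  then show "norm (vm_integral M \<eta> A (\<lambda>x. c * \<bar>f x\<bar>)) \<le> 2 * c * K"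
    unfolding vm_integral_eq[OF h[OF A]] using c by (simp add: mult_left_mono mult.assoc flip: mult_2)
       (metis mult.left_commute mult_left_mono)
qed

text \<open>
  The form of completeness of \<open>L\<^sub>1(\<eta>)\<close> that is needed: a series which converges absolutely for the
  supremum of the norms of the integrals converges \<open>\<eta>\<close>-almost everywhere to an integrable function.
\<close>

lemma vm_integrable_suminf:
  fixes \<eta> :: "'w set \<Rightarrow> 'a::banach"
  assumes \<eta>: "\<eta> \<in> ca M" and g: "\<And>n. vm_integrable M \<eta> (g n)"
    and b: "\<And>n A. A \<in> sets M \<Longrightarrow> norm (vm_integral M \<eta> A (g n)) \<le> b n" "summable b"
  shows "vm_integrable M \<eta> (\<lambda>x. \<Sum>n. g n x)"
    and "{x \<in> space M. \<not> summable (\<lambda>n. g n x)} \<in> vm_null_sets M \<eta>"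
proof -
  have [measurable]: "g n \<in> borel_measurable M" for n using g by (simp add: vm_integrable_def)
  have i: "integrable (variation_measure M (blinfun_apply z' \<circ> \<eta>)) (g n)" for z' n
    using g by (simp add: vm_integrable_def)
  have s: "summable (\<lambda>n. \<integral>x. \<bar>g n x\<bar> \<partial>variation_measure M (blinfun_apply z' \<circ> \<eta>))" for z'
  proof (rule summable_comparison_test_ev)
    show "summable (\<lambda>n. 2 * (norm z' * b n))"
      using b(2) by (intro summable_mult)
    have "(\<integral>x. \<bar>g n x\<bar> \<partial>variation_measure M (blinfun_apply z' \<circ> \<eta>)) \<le> 2 * (norm z' * b n)" for n
      by (rule variation_integral_le_if_vm_integrals_le[OF \<eta> g b(1)])
    then show "\<forall>\<^sub>F n in sequentially. norm (\<integral>x. \<bar>g n x\<bar> \<partial>variation_measure M (blinfun_apply z' \<circ> \<eta>))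
        \<le> 2 * (norm z' * b n)"
      by simp
  qed
  note sums = signed_set_integral_sums[OF ca_functional[OF \<eta>] i s]
  show "vm_integrable M \<eta> (\<lambda>x. \<Sum>n. g n x)"
    unfolding vm_integrable_def
  proof (intro conjI allI ballI)
    show "integrable (variation_measure M (blinfun_apply z' \<circ> \<eta>)) (\<lambda>x. \<Sum>n. g n x)" for z'
      by (rule sums(1)) (rule sets.top)
    fix A assume A: "A \<in> sets M"
    have "summable (\<lambda>n. vm_integral M \<eta> A (g n))"
      by (rule summable_comparison_test_ev[OF _ b(2)]) (use b(1)[OF A] in simp)
    then obtain z where z: "(\<lambda>n. vm_integral M \<eta> A (g n)) sums z" unfolding summable_def by blast
    have "has_vm_integral M \<eta> A (\<lambda>x. \<Sum>n. g n x) z"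
      unfolding has_vm_integral_def
    proof
      fix z' :: "'a \<Rightarrow>\<^sub>L real"
      have "(\<lambda>n. blinfun_apply z' (vm_integral M \<eta> A (g n))) sums blinfun_apply z' z"
        by (rule bounded_linear.sums[OF blinfun.bounded_linear_right z])
      moreover have "blinfun_apply z' (vm_integral M \<eta> A (g n)) = signed_set_integral M (blinfun_apply z' \<circ> \<eta>) A (g n)" for n
        using vm_integrable_imp_has_vm_integral[OF g A] by (simp add: has_vm_integral_def)
      ultimately show "blinfun_apply z' z = signed_set_integral M (blinfun_apply z' \<circ> \<eta>) A (\<lambda>x. \<Sum>n. g n x)"
        using sums(2)[OF A, of z'] sums_unique2 by simp
    qed
    then show "\<exists>z. has_vm_integral M \<eta> A (\<lambda>x. \<Sum>n. g n x) z" by blast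
  qed measurable
  let ?N = "{x \<in> space M. \<not> summable (\<lambda>n. g n x)}"
  have N: "?N \<in> sets M"
    unfolding summable_iff_convergent Cauchy_convergent_iff[symmetric] by measurable
  show "?N \<in> vm_null_sets M \<eta>"
    unfolding vm_null_sets_def
  proof (intro CollectI conjI N ballI impI)
    fix B assume B: "B \<in> sets M" "B \<subseteq> ?N"
    have "blinfun_apply z' (\<eta> B) = blinfun_apply z' 0" for z' :: "'a \<Rightarrow>\<^sub>L real"
    proof -
      let ?V = "variation_measure M (blinfun_apply z' \<circ> \<eta>)"
      have "AE x in ?V. summable (\<lambda>n. g n x)"
        using AE_summable_norm[OF i s] by eventually_elim (rule summable_rabs_cancel)
      then have "AE x in ?V. x \<notin> B" using B by (auto elim!: eventually_mono)
      then have "emeasure ?V B = 0"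
        using B(1) AE_iff_measurable[of B ?V "\<lambda>x. x \<notin> B"] sets.sets_into_space[OF B(1)] by auto
      then have "measure ?V B = 0" by (simp add: measure_def)
      then show ?thesis
        using abs_le_variation[OF ca_functional[OF \<eta>, of z'] B(1)] by simp
    qed
    then show "\<eta> B = 0" by (rule functionals_separate)
  qed
qed

section \<open>Lifting a vector measure through an operator\<close>

text \<open>
  If \<open>T x = T y\<close>, the set function on \<open>nat set\<close> that is \<open>x - y\<close> on infinite sets and \<open>0\<close> on finite
  ones is annihilated by the functionals in question, yet it is countably additive only if \<open>x = y\<close>.
\<close>

lemma OT_property_imp_inj:
  assumes "OT_property (dual_map T ` W)"
  shows "inj (blinfun_apply T)"
proof (rule injI)
  fix x y assume xy: "blinfun_apply T x = blinfun_apply T y"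
  define \<theta> where "\<theta> A = (if finite A then 0 else x - y)" for A :: "nat set"
  have "blinfun_apply w \<circ> \<theta> \<in> ca (count_space UNIV)" if "w \<in> dual_map T ` W" for w
  proof -
    have "blinfun_apply w (\<theta> A) = 0" for A
      using that xy by (auto simp: dual_map_def \<theta>_def blinfun.diff_right)
    then show ?thesis by (simp add: ca_def)
  qed
  then have "\<theta> \<in> ca (count_space UNIV)"
    using assms unfolding OT_property_def OT_property_on_def by blast
  then have "(\<lambda>n::nat. \<theta> {n}) sums \<theta> (\<Union>n. {n})"
    by (rule caD) (auto simp: disjoint_family_on_def)
  moreover have "(\<lambda>n::nat. \<theta> {n}) sums 0" by (simp add: \<theta>_def)
  ultimately have "\<theta> UNIV = 0" using sums_unique2 by auto
  then show "x = y" by (simp add: \<theta>_def)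
qed

lemma OT_property_imp_ca:
  fixes T :: "'a::real_normed_vector \<Rightarrow>\<^sub>L 'b::real_normed_vector" and \<theta> :: "'w set \<Rightarrow> 'a"
  assumes "OT_property (dual_map T ` W)"
    and "\<And>y. y \<in> W \<Longrightarrow> (\<lambda>A. blinfun_apply y (blinfun_apply T (\<theta> A))) \<in> ca M"
  shows "\<theta> \<in> ca M"
proof -
  have "blinfun_apply x \<circ> \<theta> \<in> ca M" if "x \<in> dual_map T ` W" for x
    using that assms(2) by (auto simp: dual_map_def o_def)
  then show ?thesis
    using OT_property_imp_OT_property_on[OF assms(1), where 'w = 'w]
    unfolding OT_property_on_def by blast
qed

context
  fixes T :: "'a::banach \<Rightarrow>\<^sub>L 'b::banach" and M :: "'w measure" and \<nu> :: "'w set \<Rightarrow> 'b"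
  assumes OT: "OT_property (dual_map T ` cball 0 1)"
    and \<nu>: "\<nu> \<in> ca M"
    and range: "integration_op M \<nu> ` L1 M \<nu> \<subseteq> range (blinfun_apply T)"
begin

text \<open>
  The integral of \<open>f\<close> over \<open>A\<close> is the integral of \<open>indicator A * f\<close> over the whole space, hence lies in
  the range of \<open>T\<close>. The Orlicz-Thomas property makes the lifted indefinite integral countably
  additive.
\<close>

lemma indefinite_integral_lift:
  assumes f: "vm_integrable M \<nu> f"
  obtains \<theta> where "\<theta> \<in> ca M" "\<And>A. A \<in> sets M \<Longrightarrow> blinfun_apply T (\<theta> A) = vm_integral M \<nu> A f"
proof -
  have "vm_integral M \<nu> A f \<in> range (blinfun_apply T)" if A: "A \<in> sets M" for A
  proof -
    let ?g = "\<lambda>x. indicator A x * f x"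
    have g: "vm_integrable M \<nu> ?g" by (rule vm_integrable_restrict[OF \<nu> f A])
    have "vm_integral M \<nu> (space M) ?g = vm_integral M \<nu> A f"
      by (rule vm_integral_eq)
        (use vm_integrable_imp_has_vm_integral[OF f A] A in \<open>simp add: has_vm_integral_restrict\<close>)
    then show ?thesis
      using L1_class_values(1,3)[OF \<nu> g] range by (metis image_subset_iff)
  qed
  then have "\<forall>A. \<exists>x. A \<in> sets M \<longrightarrow> blinfun_apply T x = vm_integral M \<nu> A f" by (metis rangeE)
  then obtain \<theta> where \<theta>: "\<And>A. A \<in> sets M \<Longrightarrow> blinfun_apply T (\<theta> A) = vm_integral M \<nu> A f" by metis
  have "\<theta> \<in> ca M"
  proof (rule OT_property_imp_ca[OF OT])
    fix y :: "'b \<Rightarrow>\<^sub>L real"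
    have "(\<lambda>A. signed_set_integral M (blinfun_apply y \<circ> \<nu>) A f) \<in> ca M"
      using f by (intro signed_set_integral_ca ca_functional \<nu>) (simp add: vm_integrable_def)
    then show "(\<lambda>A. blinfun_apply y (blinfun_apply T (\<theta> A))) \<in> ca M"
      by (rule ca_cong)
        (use vm_integrable_imp_has_vm_integral[OF f] in \<open>simp add: \<theta> has_vm_integral_def\<close>)
  qed
  then show thesis using \<theta> that by blast
qed

lemma measure_lift:
  "\<exists>\<nu>'\<in>ca M. \<forall>A\<in>sets M. blinfun_apply T (\<nu>' A) = \<nu> A"
proof -
  have h: "has_vm_integral M \<nu> A (indicator (space M)) (\<nu> A)" if "A \<in> sets M" for A
    using has_vm_integral_indicator[OF \<nu> that sets.top] that by (simp add: Int_absorb2 sets.sets_into_space)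
  have "vm_integrable M \<nu> (indicator (space M))"
    unfolding vm_integrable_def
    using h integrable_variation_bounded[OF ca_functional[OF \<nu>], of "indicator (space M)" 1] by auto
  then obtain \<theta> where "\<theta> \<in> ca M"
    "\<And>A. A \<in> sets M \<Longrightarrow> blinfun_apply T (\<theta> A) = vm_integral M \<nu> A (indicator (space M))"
    using indefinite_integral_lift by blast
  then show ?thesis using vm_integral_eq[OF h] by force
qed

context
  fixes \<nu>' :: "'w set \<Rightarrow> 'a"
  assumes \<nu>': "\<nu>' \<in> ca M" and T\<nu>': "\<forall>A\<in>sets M. blinfun_apply T (\<nu>' A) = \<nu> A"
begin

lemma functional_lift_cong:
  "variation_measure M (blinfun_apply y \<circ> \<nu>) = variation_measure M (blinfun_apply (y o\<^sub>L T) \<circ> \<nu>')"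
  "signed_set_integral M (blinfun_apply y \<circ> \<nu>) = signed_set_integral M (blinfun_apply (y o\<^sub>L T) \<circ> \<nu>')"
  by (intro variation_cong signed_set_integral_cong_measure, simp add: T\<nu>')+

lemma has_vm_integral_image:
  "has_vm_integral M \<nu>' A f z \<Longrightarrow> has_vm_integral M \<nu> A f (blinfun_apply T z)"
  unfolding has_vm_integral_def functional_lift_cong
  by (metis blinfun_apply_blinfun_compose)

lemma vm_integrable_image:
  assumes "vm_integrable M \<nu>' f"
  shows "vm_integrable M \<nu> f"
  using assms has_vm_integral_image unfolding vm_integrable_def functional_lift_cong by blast

text \<open>
  On sets where \<open>f\<close> is bounded, \<open>f\<close> is integrable with respect to \<open>\<nu>'\<close>, and injectivity of \<open>T\<close>
  identifies the integral with \<open>\<theta>\<close>. As \<open>\<theta>\<close> is countably additive, this extends to all measurable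
  sets.
\<close>

lemma has_vm_integral_lift:
  assumes f: "vm_integrable M \<nu> f"
    and \<theta>: "\<theta> \<in> ca M" "\<And>A. A \<in> sets M \<Longrightarrow> blinfun_apply T (\<theta> A) = vm_integral M \<nu> A f"
  shows "vm_integrable M \<nu>' f" "A \<in> sets M \<Longrightarrow> has_vm_integral M \<nu>' A f (\<theta> A)"
proof -
  have [measurable]: "f \<in> borel_measurable M" using f by (simp add: vm_integrable_def)
  have agree: "has_vm_integral M \<nu>' A f (\<theta> A)"
    if A: "A \<in> sets M" and bd: "\<And>x. x \<in> A \<Longrightarrow> \<bar>f x\<bar> \<le> real n" for n A
  proof -
    have "\<exists>z. has_vm_integral M \<nu>' A (\<lambda>x. indicator A x * f x) z"
      using A bd by (intro bounded_has_vm_integral[OF \<nu>', where c = n]) (auto split: split_indicator)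
    then obtain z where z: "has_vm_integral M \<nu>' A f z"
      by (auto simp: has_vm_integral_restrict)
    have "blinfun_apply T z = blinfun_apply T (\<theta> A)"
      using vm_integral_eq[OF has_vm_integral_image[OF z]] \<theta>(2)[OF A] by simp
    then have "z = \<theta> A" using OT_property_imp_inj[OF OT] by (simp add: inj_eq)
    then show ?thesis using z by simp
  qed
  have ext: "integrable (variation_measure M (blinfun_apply x' \<circ> \<nu>')) f"
    "A \<in> sets M \<Longrightarrow> (blinfun_apply x' \<circ> \<theta>) A = signed_set_integral M (blinfun_apply x' \<circ> \<nu>') A f" for x' A
    by (rule integrable_if_truncations_extend[OF ca_functional[OF \<nu>'] ca_functional[OF \<theta>(1)]];
        use agree in \<open>auto simp: has_vm_integral_def\<close>)+
  show int: "has_vm_integral M \<nu>' A f (\<theta> A)" if "A \<in> sets M" for A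
    using ext(2)[OF that] by (simp add: has_vm_integral_def)
  show "vm_integrable M \<nu>' f"
    using ext(1) int unfolding vm_integrable_def by auto
qed

lemma vm_integrable_lift_iff: "vm_integrable M \<nu> f \<longleftrightarrow> vm_integrable M \<nu>' f"
  using indefinite_integral_lift has_vm_integral_lift(1) vm_integrable_image by metis

lemma vm_integral_lift:
  assumes f: "vm_integrable M \<nu> f"
  shows "A \<in> sets M \<Longrightarrow> vm_integral M \<nu> A f = blinfun_apply T (vm_integral M \<nu>' A f)"
    and "\<exists>K. \<forall>A\<in>sets M. norm (vm_integral M \<nu>' A f) \<le> K"
proof -
  obtain \<theta> where \<theta>: "\<theta> \<in> ca M" "\<And>A. A \<in> sets M \<Longrightarrow> blinfun_apply T (\<theta> A) = vm_integral M \<nu> A f"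
    using indefinite_integral_lift[OF f] by blast
  have eq: "vm_integral M \<nu>' A f = \<theta> A" if "A \<in> sets M" for A
    by (rule vm_integral_eq[OF has_vm_integral_lift(2)[OF f \<theta> that]])
  show "vm_integral M \<nu> A f = blinfun_apply T (vm_integral M \<nu>' A f)" if "A \<in> sets M"
    using eq \<theta>(2) that by simp
  obtain K where "\<And>A. A \<in> sets M \<Longrightarrow> norm (\<theta> A) \<le> K" using ca_bounded[OF \<theta>(1)] by blast
  then show "\<exists>K. \<forall>A\<in>sets M. norm (vm_integral M \<nu>' A f) \<le> K" using eq by auto
qed

lemma vm_null_sets_lift: "vm_null_sets M \<nu> = vm_null_sets M \<nu>'"
proof -
  have "\<nu> B = 0 \<longleftrightarrow> \<nu>' B = 0" if "B \<in> sets M" for B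
    using T\<nu>' that OT_property_imp_inj[OF OT] by (metis blinfun.zero_right inj_eq)
  then show ?thesis by (auto simp: vm_null_sets_def)
qed

lemma vm_norm_image_le:
  assumes f: "vm_integrable M \<nu> f"
  shows "vm_norm M \<nu> f \<le> 2 * norm T * vm_norm M \<nu>' f" "0 \<le> vm_norm M \<nu>' f"
proof -
  have f': "vm_integrable M \<nu>' f" using f by (simp add: vm_integrable_lift_iff)
  obtain K where "\<And>A. A \<in> sets M \<Longrightarrow> norm (vm_integral M \<nu>' A f) \<le> K"
    using vm_integral_lift(2)[OF f] by blast
  note le = vm_norm_bounds(1)[OF \<nu>' f' this]
  show "0 \<le> vm_norm M \<nu>' f"
    using le[OF _ sets.top] norm_ge_zero order_trans by blast
  have "norm (vm_integral M \<nu> A f) \<le> norm T * vm_norm M \<nu>' f" if "A \<in> sets M" for A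
    unfolding vm_integral_lift(1)[OF f that]
    using norm_blinfun[of T "vm_integral M \<nu>' A f"] mult_left_mono[OF le[OF _ that] norm_ge_zero[of T]] by force
  from vm_norm_bounds(2)[OF \<nu> f this] show "vm_norm M \<nu> f \<le> 2 * norm T * vm_norm M \<nu>' f" by simp
qed

text \<open>
  A gliding sum takes the place of the closed graph theorem. Were there no such constant, one could
  choose nonnegative \<open>g n\<close> whose integrals with respect to \<open>\<nu>\<close> have norm at most \<open>2 * (1 / 2) ^ n\<close> while
  their integral against the variation of \<open>x' n \<circ> \<nu>'\<close> is \<open>2 ^ n\<close>, for some functional \<open>x' n\<close> in the unit
  ball. Their sum is integrable with respect to \<open>\<nu>\<close>, hence with respect to \<open>\<nu>'\<close>, and it dominates
  every \<open>g n\<close>, which is impossible.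
\<close>

lemma vm_norm_lift_le:
  obtains C where "0 < C" "\<And>f K. vm_integrable M \<nu> f \<Longrightarrow>
    (\<And>A. A \<in> sets M \<Longrightarrow> norm (vm_integral M \<nu> A f) \<le> K) \<Longrightarrow> vm_norm M \<nu>' f \<le> C * K"
proof -
  have "\<exists>C>0. \<forall>f K. vm_integrable M \<nu> f \<longrightarrow>
    (\<forall>A\<in>sets M. norm (vm_integral M \<nu> A f) \<le> K) \<longrightarrow> vm_norm M \<nu>' f \<le> C * K"
  proof (rule ccontr)
    assume neg: "\<not> ?thesis"
    define V where "V x' = variation_measure M (blinfun_apply x' \<circ> \<nu>')" for x' :: "'a \<Rightarrow>\<^sub>L real"
    have "\<exists>f K x'. vm_integrable M \<nu> f \<and> (\<forall>A\<in>sets M. norm (vm_integral M \<nu> A f) \<le> K) \<and>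
      norm x' \<le> 1 \<and> 4 ^ n * K < (\<integral>x. \<bar>f x\<bar> \<partial>V x')" for n :: nat
    proof -
      have "(0::real) < 4 ^ n" by simp
      then obtain f K where f: "vm_integrable M \<nu> f" "\<forall>A\<in>sets M. norm (vm_integral M \<nu> A f) \<le> K"
        "\<not> vm_norm M \<nu>' f \<le> 4 ^ n * K"
        using neg by blast
      have "\<exists>x'\<in>cball (0 :: 'a \<Rightarrow>\<^sub>L real) 1. \<not> (\<integral>x. \<bar>f x\<bar> \<partial>V x') \<le> 4 ^ n * K"
      proof (rule ccontr)
        assume "\<not> ?thesis"
        then have "vm_norm M \<nu>' f \<le> 4 ^ n * K"
          unfolding vm_norm_def V_def by (intro cSUP_least) auto
        with f(3) show False by simp
      qed
      then obtain x' where "norm x' \<le> 1" "4 ^ n * K < (\<integral>x. \<bar>f x\<bar> \<partial>V x')"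
        by (auto simp: not_le)
      then show ?thesis using f(1,2) by blast
    qed
    then obtain f K x' where f: "\<And>n. vm_integrable M \<nu> (f n)"
      and K: "\<And>n A. A \<in> sets M \<Longrightarrow> norm (vm_integral M \<nu> A (f n)) \<le> K n"
      and x': "\<And>n. norm (x' n) \<le> 1" and big: "\<And>n::nat. 4 ^ n * K n < (\<integral>x. \<bar>f n x\<bar> \<partial>V (x' n))"
      by metis
    define I where "I n = (\<integral>x. \<bar>f n x\<bar> \<partial>V (x' n))" for n
    have K0: "0 \<le> K n" for n using K[OF sets.top, of n] norm_ge_zero order_trans by blast
    have I: "4 ^ n * K n < I n" "0 < I n" for n
      using big[of n] K0[of n] by (auto simp: I_def intro: le_less_trans[rotated])
    \<comment> \<open>Normalising by \<open>I n > 4 ^ n * K n\<close> rather than by \<open>K n\<close>, which may be \<open>0\<close>.\<close>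
    define g where "g n x = 2 ^ n / I n * \<bar>f n x\<bar>" for n x
    have c: "0 \<le> 2 ^ n / I n" for n using I(2)[of n] by simp
    have g: "vm_integrable M \<nu> (g n)" for n
      unfolding g_def by (rule scaled_abs_vm_integrable(1)[OF \<nu> f K c])
    have g_le: "norm (vm_integral M \<nu> A (g n)) \<le> 2 * (1 / 2) ^ n" if "A \<in> sets M" for A n
    proof -
      have "norm (vm_integral M \<nu> A (g n)) \<le> 2 * (2 ^ n / I n) * K n"
        unfolding g_def by (rule scaled_abs_vm_integrable(2)[OF \<nu> f K c that])
      also have "\<dots> \<le> 2 * (1 / 2) ^ n"
      proof -
        have "2 ^ n * (2 ^ n * K n) \<le> I n"
          using I(1)[of n] by (simp flip: mult.assoc power_mult_distrib)
        then show ?thesis using I(2)[of n] by (simp add: field_simps power_one_over)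
      qed
      finally show ?thesis .
    qed
    have geo: "summable (\<lambda>n. 2 * (1 / 2 :: real) ^ n)"
      by (intro summable_mult summable_geometric) simp
    define h where "h x = (\<Sum>n. g n x)" for x
    have h: "vm_integrable M \<nu> h"
      and N: "{x \<in> space M. \<not> summable (\<lambda>n. g n x)} \<in> vm_null_sets M \<nu>'" (is "?N \<in> _")
      using vm_integrable_suminf[OF \<nu> g g_le geo] vm_null_sets_lift by (simp_all add: h_def[abs_def])
    have h': "vm_integrable M \<nu>' h" using h by (simp add: vm_integrable_lift_iff)
    obtain L where L: "\<And>A. A \<in> sets M \<Longrightarrow> norm (vm_integral M \<nu>' A h) \<le> L"
      using vm_integral_lift(2)[OF h] by blast
    have L0: "0 \<le> L" using L[OF sets.top] norm_ge_zero order_trans by blast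
    have "2 ^ n \<le> 2 * L" for n
    proof -
      have gm: "g n \<in> borel_measurable M" using g by (simp add: vm_integrable_def)
      have "emeasure (V (x' n)) ?N = 0"
        unfolding V_def using N
        by (intro variation_null[OF ca_functional[OF \<nu>']]) (auto simp: vm_null_sets_def)
      then have ae: "AE x in V (x' n). x \<notin> ?N"
        by (intro AE_not_in) (use N in \<open>auto simp: V_def null_sets_def vm_null_sets_def\<close>)
      have "AE x in V (x' n). \<bar>g n x\<bar> \<le> \<bar>h x\<bar>"
        using ae AE_space
      proof eventually_elim
        case (elim x)
        then have s: "summable (\<lambda>k. g k x)" by (simp add: V_def)
        have pos: "0 \<le> g k x" for k unfolding g_def using c by (rule mult_nonneg_nonneg) simp
        have "g n x \<le> h x"
          unfolding h_def using sum_le_suminf[OF s, of "{n}"] pos by simp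
        then show ?case using pos[of n] by simp
      qed
      then have "(\<integral>x. \<bar>g n x\<bar> \<partial>V (x' n)) \<le> (\<integral>x. \<bar>h x\<bar> \<partial>V (x' n))"
        unfolding V_def using h'
        by (intro variation_integral_mono(2)[OF ca_functional[OF \<nu>'] _ gm]) (auto simp: vm_integrable_def)
      also have "\<dots> \<le> 2 * (norm (x' n) * L)"
        unfolding V_def by (rule variation_integral_le_if_vm_integrals_le[OF \<nu>' h' L])
      also have "\<dots> \<le> 2 * L" using mult_right_mono[OF x' L0, of n] by simp
      also have "(\<integral>x. \<bar>g n x\<bar> \<partial>V (x' n)) = 2 ^ n"
        using I(2)[of n] by (simp add: g_def abs_mult I_def)
      finally show ?thesis .
    qed
    moreover obtain n where "2 * L < 2 ^ n" using real_arch_pow[of 2 "2 * L"] by auto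
    ultimately show False by (meson not_le)
  qed
  then show thesis using that by blast
qed

end

end

theorem proposition3p7:
  fixes T :: "'a::banach \<Rightarrow>\<^sub>L 'b::banach"
    and M :: "'w measure"
    and \<nu> :: "'w set \<Rightarrow> 'b"
  assumes "OT_property (dual_map T ` cball 0 1)"
    and "\<nu> \<in> ca M"
    and "integration_op M \<nu> ` L1 M \<nu> \<subseteq> range (blinfun_apply T)"
  shows "\<exists>\<nu>' :: 'w set \<Rightarrow> 'a. \<nu>' \<in> ca M \<and>
           (\<forall>A\<in>sets M. \<nu> A = blinfun_apply T (\<nu>' A)) \<and>
           vm_null_sets M \<nu> = vm_null_sets M \<nu>' \<and>
           L1 M \<nu> = L1 M \<nu>' \<and>
           (\<exists>c C. 0 < c \<and> 0 < C \<and>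
              (\<forall>F\<in>L1 M \<nu>. c * L1_norm M \<nu> F \<le> L1_norm M \<nu>' F \<and>
                            L1_norm M \<nu>' F \<le> C * L1_norm M \<nu> F)) \<and>
           (\<forall>F\<in>L1 M \<nu>. integration_op M \<nu> F = blinfun_apply T (integration_op M \<nu>' F))"
proof -
  obtain \<nu>' where \<nu>': "\<nu>' \<in> ca M" and T\<nu>': "\<forall>A\<in>sets M. blinfun_apply T (\<nu>' A) = \<nu> A"
    using measure_lift[OF assms] by blast
  note lift = assms \<nu>' T\<nu>'
  have int: "vm_integrable M \<nu> = vm_integrable M \<nu>'"
    using vm_integrable_lift_iff[OF lift] by blast
  have null: "vm_null_sets M \<nu> = vm_null_sets M \<nu>'"
    by (rule vm_null_sets_lift[OF lift])
  have ae: "vm_ae_eq M \<nu> = vm_ae_eq M \<nu>'"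
    unfolding vm_ae_eq_def int null ..
  obtain C where C: "0 < C" "\<And>f K. vm_integrable M \<nu> f \<Longrightarrow>
      (\<And>A. A \<in> sets M \<Longrightarrow> norm (vm_integral M \<nu> A f) \<le> K) \<Longrightarrow> vm_norm M \<nu>' f \<le> C * K"
    using vm_norm_lift_le[OF lift] by blast
  \<comment> \<open>The summand \<open>1\<close> covers \<open>T = 0\<close>, where \<open>1 / (2 * norm T)\<close> would not be positive.\<close>
  define c where "c = 1 / (2 * norm T + 1)"
  have c: "0 < c" unfolding c_def by (simp add: add_nonneg_pos)
  have norms: "c * L1_norm M \<nu> F \<le> L1_norm M \<nu>' F" "L1_norm M \<nu>' F \<le> C * L1_norm M \<nu> F"
    and ops: "integration_op M \<nu> F = blinfun_apply T (integration_op M \<nu>' F)"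
    if F: "F \<in> L1 M \<nu>" for F
  proof -
    obtain f where f: "vm_integrable M \<nu> f" and F_eq: "F = vm_ae_eq M \<nu> `` {f}"
      using F by (rule L1_E)
    have f': "vm_integrable M \<nu>' f" using f by (simp add: int)
    note vals = L1_class_values(2,3)[OF assms(2) f, folded F_eq]
      L1_class_values(2,3)[OF \<nu>' f', folded ae, folded F_eq]
    show "integration_op M \<nu> F = blinfun_apply T (integration_op M \<nu>' F)"
      unfolding vals by (rule vm_integral_lift(1)[OF lift f sets.top])
    have "vm_norm M \<nu> f \<le> (2 * norm T + 1) * vm_norm M \<nu>' f"
      using vm_norm_image_le[OF lift f] by (simp add: distrib_right)
    then show "c * L1_norm M \<nu> F \<le> L1_norm M \<nu>' F"
      unfolding vals c_def by (simp add: divide_le_eq add_nonneg_pos mult.commute)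
    obtain K where K: "\<forall>A\<in>sets M. norm (vm_integral M \<nu>' A f) \<le> K"
      using vm_integral_lift(2)[OF lift f] by blast
    have "norm (vm_integral M \<nu> A f) \<le> norm T * K" if "A \<in> sets M" for A
      unfolding vm_integral_lift(1)[OF lift f that]
      using norm_blinfun[of T "vm_integral M \<nu>' A f"] mult_left_mono[OF K[rule_format, OF that] norm_ge_zero[of T]]
      by linarith
    from vm_norm_bounds(1)[OF assms(2) f this] show "L1_norm M \<nu>' F \<le> C * L1_norm M \<nu> F"
      unfolding vals by (intro C(2)[OF f])
  qed
  have "L1 M \<nu> = L1 M \<nu>'" by (simp add: L1_def int ae)
  then show ?thesis
    using \<nu>' T\<nu>' null c C(1) norms ops
    by (intro exI[of _ \<nu>'] conjI exI[of _ c] exI[of _ C] ballI) auto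
qed

end
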